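(* The generator $G$ of the minimal semigroup $(Z(t))_{t\ge0}$ is $G=\overline{A+K}$ (the closure of $A+K$ in $\mathcal X$). In particular $(Z(t))_{t\ge0}$ is honest (conservative): $$\int_{\mathbb R^3\times\mathbb R^3}Z(t)f(x,v)\,dx\,dv=\int_{\mathbb R^3\times\mathbb R^3}f(x,v)\,dx\,dv\qquad\text{for all }f\in\mathcal X,\ t\ge0.$$
   Context: Fix masses $m,m_1>0$, a constant restitution coefficient $\epsilon\in(0,1)$, a bulk velocity $u_1\in\mathbb R^3$ and a temperature $\vartheta_1>0$. Let $\mathcal M_1(v)=\big(\frac{m_1}{2\pi\vartheta_1}\big)^{3/2}\exp\big(-\frac{m_1|v-u_1|^2}{2\vartheta_1}\big)$, $\alpha=\frac{m_1}{m+m_1}$, $\beta=\frac{1-\epsilon}{2}$, $\gamma=\alpha\frac{1-\beta}{1-2\beta}$, $\bar\gamma=(1-\alpha)\frac{1-\beta}{1-2\beta}$. For $v,w\in\mathbb R^3$, $n\in\mathbb S^2$, $q=v-w$, let $v_\star=v-2\gamma(q\cdot n)n$, $w_\star=w+2\bar\gamma(q\cdot n)n$, and $\sigma(v)=\int_{\mathbb R^3\times\mathbb S^2}|q\cdot n|\mathcal M_1(w)\,dw\,dn$. Let $\mathcal X=L^1(\mathbb R^3\times\mathbb R^3,dx\otimes dv)$; $T_0f=-v\cdot\nabla_xf$ with $\mathscr D(T_0)=\{f\in\mathcal X:v\cdot\nabla_xf\in\mathcal X\}$; $\Sigma f=-\sigma(v)f$ with $\mathscr D(\Sigma)=\{f\in\mathcal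 X:\sigma f\in\mathcal X\}$; $A=T_0+\Sigma$ on $\mathscr D(A)=\mathscr D(T_0)\cap\mathscr D(\Sigma)$ (it generates the contraction semigroup $V(t)f(x,v)=e^{-\sigma(v)t}f(x-tv,v)$); and $K$, with $\mathscr D(K)=\mathscr D(A)$, is $Kf(x,v)=\epsilon^{-2}\int_{\mathbb R^3\times\mathbb S^2}|q\cdot n|f(x,v_\star)\mathcal M_1(w_\star)\,dw\,dn$. Then $K\ge0$ and $\int(Af+Kf)\,dx\,dv=0$ for $f\in\mathscr D(A)$, $f\ge0$, and by substochastic perturbation theory there is a positive contraction $C_0$-semigroup $(Z(t))_{t\ge0}$ on $\mathcal X$ whose generator $G$ extends $A+K$ and which is minimal: any positive $C_0$-semigroup $(T(t))$ whose generator extends $A+K$ satisfies $T(t)\ge Z(t)$ for all $t\ge0$. *)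

theory Defs
  imports "HOL-Analysis.Analysis"
begin

type_synonym vec3 = "real^3"
type_synonym phase = "vec3 \<times> vec3"   (* (x, v) *)
type_synonym fn = "phase \<Rightarrow> real"

section \<open>The space X = L^1(R^3 x R^3, dx dv), handled through representatives\<close>

definition L1 :: "fn \<Rightarrow> bool" where
  "L1 f \<longleftrightarrow> integrable lborel f"

definition aeq :: "fn \<Rightarrow> fn \<Rightarrow> bool" where
  "aeq f g \<longleftrightarrow> (AE z in lborel. f z = g z)"

definition l1norm :: "fn \<Rightarrow> real" where
  "l1norm f = (\<integral>z. \<bar>f z\<bar> \<partial>lborel)"

section \<open>Surface measure on the unit sphere S^2 (cone-measure construction)\<close>

text \<open>For Borel g on the sphere, the integral of g over S^2 w.r.t. surface measure equals
  3 times the integral over the unit ball of g(y/|y|).\<close>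
definition sphere_meas :: "vec3 measure" where
  "sphere_meas = distr (density lborel (\<lambda>y. ennreal 3 * indicator (ball 0 1) y)) borel
                       (\<lambda>y. y /\<^sub>R norm y)"

fun Ck :: "nat \<Rightarrow> (phase \<Rightarrow> real) \<Rightarrow> bool" where
  "Ck 0 f \<longleftrightarrow> continuous_on UNIV f"
| "Ck (Suc k) f \<longleftrightarrow> continuous_on UNIV f \<and> (\<forall>z. f differentiable (at z)) \<and>
      (\<forall>i\<in>Basis. Ck k (\<lambda>z. frechet_derivative f (at z) i))"

definition test_fun :: "(phase \<Rightarrow> real) \<Rightarrow> bool" where
  "test_fun \<phi> \<longleftrightarrow> (\<forall>k. Ck k \<phi>) \<and> compact (closure {z. \<phi> z \<noteq> 0})"

definition Maxw :: "real \<Rightarrow> vec3 \<Rightarrow> real \<Rightarrow> vec3 \<Rightarrow> real" where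
  "Maxw m1 u1 th1 v = (m1 / (2 * pi * th1)) powr (3/2) * exp (- m1 * (norm (v - u1))\<^sup>2 / (2 * th1))"

definition alpha :: "real \<Rightarrow> real \<Rightarrow> real" where
  "alpha m m1 = m1 / (m + m1)"

definition beta :: "real \<Rightarrow> real" where
  "beta eps = (1 - eps) / 2"

definition gam :: "real \<Rightarrow> real \<Rightarrow> real \<Rightarrow> real" where
  "gam m m1 eps = alpha m m1 * (1 - beta eps) / (1 - 2 * beta eps)"

definition gambar :: "real \<Rightarrow> real \<Rightarrow> real \<Rightarrow> real" where
  "gambar m m1 eps = (1 - alpha m m1) * (1 - beta eps) / (1 - 2 * beta eps)"

definition vstar :: "real \<Rightarrow> real \<Rightarrow> real \<Rightarrow> vec3 \<Rightarrow> vec3 \<Rightarrow> vec3 \<Rightarrow> vec3" where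
  "vstar m m1 eps v w n = v - (2 * gam m m1 eps * ((v - w) \<bullet> n)) *\<^sub>R n"

definition wstar :: "real \<Rightarrow> real \<Rightarrow> real \<Rightarrow> vec3 \<Rightarrow> vec3 \<Rightarrow> vec3 \<Rightarrow> vec3" where
  "wstar m m1 eps v w n = w + (2 * gambar m m1 eps * ((v - w) \<bullet> n)) *\<^sub>R n"

definition coll_freq :: "real \<Rightarrow> vec3 \<Rightarrow> real \<Rightarrow> vec3 \<Rightarrow> real" where
  "coll_freq m1 u1 th1 v =
     (\<integral>p. \<bar>(v - fst p) \<bullet> snd p\<bar> * Maxw m1 u1 th1 (fst p) \<partial>(lborel \<Otimes>\<^sub>M sphere_meas))"

definition Kop :: "real \<Rightarrow> real \<Rightarrow> real \<Rightarrow> vec3 \<Rightarrow> real \<Rightarrow> fn \<Rightarrow> fn" where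
  "Kop m m1 eps u1 th1 f z =
     (let x = fst z; v = snd z in
      eps powr (-2) *
      (\<integral>p. \<bar>(v - fst p) \<bullet> snd p\<bar> * f (x, vstar m m1 eps v (fst p) (snd p)) *
            Maxw m1 u1 th1 (wstar m m1 eps v (fst p) (snd p)) \<partial>(lborel \<Otimes>\<^sub>M sphere_meas)))"

section \<open>Operators as relations (graphs) on representatives\<close>

text \<open>Free transport T0 f = - v . grad_x f, with v . grad_x f the distributional derivative.\<close>
definition T0rel :: "fn \<Rightarrow> fn \<Rightarrow> bool" where
  "T0rel f g \<longleftrightarrow> L1 f \<and> L1 g \<and>
     (\<forall>\<phi>. test_fun \<phi> \<longrightarrow>
        (\<integral>z. g z * \<phi> z \<partial>lborel) = (\<integral>z. f z * frechet_derivative \<phi> (at z) (snd z, 0) \<partial>lborel))"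

definition Arel :: "real \<Rightarrow> vec3 \<Rightarrow> real \<Rightarrow> fn \<Rightarrow> fn \<Rightarrow> bool" where
  "Arel m1 u1 th1 f g \<longleftrightarrow> L1 g \<and> (\<exists>h. T0rel f h \<and> L1 (\<lambda>z. coll_freq m1 u1 th1 (snd z) * f z) \<and>
       aeq g (\<lambda>z. h z - coll_freq m1 u1 th1 (snd z) * f z))"

definition AKrel :: "real \<Rightarrow> real \<Rightarrow> real \<Rightarrow> vec3 \<Rightarrow> real \<Rightarrow> fn \<Rightarrow> fn \<Rightarrow> bool" where
  "AKrel m m1 eps u1 th1 f g \<longleftrightarrow> L1 g \<and>
     (\<exists>h. Arel m1 u1 th1 f h \<and> aeq g (\<lambda>z. h z + Kop m m1 eps u1 th1 f z))"

definition op_closure :: "(fn \<Rightarrow> fn \<Rightarrow> bool) \<Rightarrow> fn \<Rightarrow> fn \<Rightarrow> bool" where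
  "op_closure R f g \<longleftrightarrow> L1 f \<and> L1 g \<and>
     (\<exists>fs gs. (\<forall>n. R (fs n) (gs n)) \<and>
        (\<lambda>n. l1norm (\<lambda>z. fs n z - f z)) \<longlonglongrightarrow> 0 \<and>
        (\<lambda>n. l1norm (\<lambda>z. gs n z - g z)) \<longlonglongrightarrow> 0)"

definition C0_semigroup :: "(real \<Rightarrow> fn \<Rightarrow> fn) \<Rightarrow> bool" where
  "C0_semigroup T \<longleftrightarrow>
     (\<forall>t\<ge>0. \<forall>f. L1 f \<longrightarrow> L1 (T t f)) \<and>
     (\<forall>t\<ge>0. \<forall>f g. L1 f \<longrightarrow> L1 g \<longrightarrow> aeq f g \<longrightarrow> aeq (T t f) (T t g)) \<and>
     (\<forall>t\<ge>0. \<forall>f g c. L1 f \<longrightarrow> L1 g \<longrightarrow>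
        aeq (T t (\<lambda>z. f z + c * g z)) (\<lambda>z. T t f z + c * T t g z)) \<and>
     (\<forall>t\<ge>0. \<exists>M. \<forall>f. L1 f \<longrightarrow> l1norm (T t f) \<le> M * l1norm f) \<and>
     (\<forall>f. L1 f \<longrightarrow> aeq (T 0 f) f) \<and>
     (\<forall>s\<ge>0. \<forall>t\<ge>0. \<forall>f. L1 f \<longrightarrow> aeq (T (s + t) f) (T s (T t f))) \<and>
     (\<forall>f. L1 f \<longrightarrow> ((\<lambda>t. l1norm (\<lambda>z. T t f z - f z)) \<longlongrightarrow> 0) (at_right 0))"

definition positive_sg :: "(real \<Rightarrow> fn \<Rightarrow> fn) \<Rightarrow> bool" where
  "positive_sg T \<longleftrightarrow> (\<forall>t\<ge>0. \<forall>f. L1 f \<longrightarrow> (AE z in lborel. 0 \<le> f z) \<longrightarrow>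
                        (AE z in lborel. 0 \<le> T t f z))"

definition contraction_sg :: "(real \<Rightarrow> fn \<Rightarrow> fn) \<Rightarrow> bool" where
  "contraction_sg T \<longleftrightarrow> (\<forall>t\<ge>0. \<forall>f. L1 f \<longrightarrow> l1norm (T t f) \<le> l1norm f)"

definition generator :: "(real \<Rightarrow> fn \<Rightarrow> fn) \<Rightarrow> fn \<Rightarrow> fn \<Rightarrow> bool" where
  "generator T f g \<longleftrightarrow> L1 f \<and> L1 g \<and>
     ((\<lambda>t. l1norm (\<lambda>z. (T t f z - f z) / t - g z)) \<longlongrightarrow> 0) (at_right 0)"

definition extends_op :: "(fn \<Rightarrow> fn \<Rightarrow> bool) \<Rightarrow> (fn \<Rightarrow> fn \<Rightarrow> bool) \<Rightarrow> bool" where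
  "extends_op G R \<longleftrightarrow> (\<forall>f g. R f g \<longrightarrow> G f g)"

end

theory Submission
  imports Defs "HOL-Probability.Distributions"
begin

text \<open>
  Fix \<open>\<lambda>\<close> large and let \<open>R = (\<lambda> - A)\<inverse>\<close>. It suffices to find, for every \<open>h\<close>, domain elements \<open>f\<close>
  of \<open>A + K\<close> with \<open>\<integral> (A + K) f = 0\<close> and \<open>(\<lambda> - A - K) f\<close> arbitrarily close to \<open>h\<close>: the generator of
  a contraction semigroup is closed and dissipative, so it is then the closure of \<open>A + K\<close>, and the
  vanishing integral passes to the generator and makes the total mass constant along orbits.

  For \<open>f = \<Sum>k<n. R (K R)\<^sup>k h\<close> one has \<open>(\<lambda> - A - K) f = h - (K R)\<^sup>n h\<close>. That \<open>(K R)\<^sup>n h \<rightarrow> 0\<close> in \<open>L\<^sup>1\<close>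
  is an energy estimate. With \<open>\<psi>(v) = 1 + |v|\<^sup>2\<close>, energy dissipation in the collisions gives
  \<open>K\<^sup>* \<psi> \<le> \<sigma> \<psi> + (\<lambda> - 1) \<psi>\<close>, hence \<open>\<parallel>\<psi> K R g\<parallel> + \<parallel>\<psi> R g\<parallel> \<le> \<parallel>\<psi> g\<parallel>\<close> for \<open>g \<ge> 0\<close>. So the norms
  \<open>\<parallel>\<psi> R (K R)\<^sup>k h\<parallel>\<close> are summable, and they dominate \<open>\<parallel>(K R)\<^sup>k\<^sup>+\<^sup>1 h\<parallel> = \<parallel>\<sigma> R (K R)\<^sup>k h\<parallel>\<close> because
  \<open>\<sigma>\<close> grows only linearly.
\<close>

section \<open>The \<open>L\<^sup>1\<close> calculus on representatives\<close>

lemma L1_add: "L1 f \<Longrightarrow> L1 g \<Longrightarrow> L1 (\<lambda>z. f z + g z)"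
  and L1_diff: "L1 f \<Longrightarrow> L1 g \<Longrightarrow> L1 (\<lambda>z. f z - g z)"
  and L1_scale: "L1 f \<Longrightarrow> L1 (\<lambda>z. c * f z)"
  by (auto simp: L1_def)

lemmas L1_intros = L1_add L1_diff L1_scale

lemma L1_measurable: "L1 f \<Longrightarrow> f \<in> borel_measurable borel"
  by (simp add: L1_def)

lemma L1_nonneg_iff:
  assumes "\<And>z. 0 \<le> f z"
  shows "L1 f \<longleftrightarrow> f \<in> borel_measurable borel \<and> (\<integral>\<^sup>+z. ennreal (f z) \<partial>lborel) < \<infinity>"
  using assms by (simp add: L1_def integrable_iff_bounded)

lemma L1_mult_bounded:
  assumes g: "L1 g" and h: "h \<in> borel_measurable borel" and bounded: "\<And>z. \<bar>h z\<bar> \<le> C"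
  shows "L1 (\<lambda>z. g z * h z)"
  unfolding L1_def
proof (rule Bochner_Integration.integrable_bound)
  show "integrable lborel (\<lambda>z. C * g z)" using g by (simp add: L1_def)
  show "(\<lambda>z. g z * h z) \<in> borel_measurable lborel" using L1_measurable[OF g] h by simp
  have "norm (g z * h z) \<le> norm (C * g z)" for z
    using mult_left_mono[of "\<bar>h z\<bar>" "\<bar>C\<bar>" "\<bar>g z\<bar>"] bounded[of z] by (simp add: abs_mult mult.commute)
  then show "AE z in lborel. norm (g z * h z) \<le> norm (C * g z)" by simp
qed

lemma l1norm_nonneg: "0 \<le> l1norm f"
  unfolding l1norm_def by simp

lemma l1norm_zero: "l1norm (\<lambda>z. 0) = 0"
  by (simp add: l1norm_def)

lemma l1norm_cong: "L1 f \<Longrightarrow> L1 g \<Longrightarrow> aeq f g \<Longrightarrow> l1norm f = l1norm g"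
  unfolding l1norm_def by (intro integral_cong_AE) (auto simp: L1_def aeq_def)

lemma integral_cong_aeq: "L1 f \<Longrightarrow> L1 g \<Longrightarrow> aeq f g \<Longrightarrow> (\<integral>z. f z \<partial>lborel) = (\<integral>z. g z \<partial>lborel)"
  by (intro integral_cong_AE) (auto simp: L1_def aeq_def)

lemma integral_L1_diff:
  "L1 f \<Longrightarrow> L1 g \<Longrightarrow> (\<integral>z. f z - g z \<partial>lborel) = (\<integral>z. f z \<partial>lborel) - (\<integral>z. g z \<partial>lborel)"
  by (simp add: L1_def)

lemma abs_integral_le_l1norm: "\<bar>\<integral>z. f z \<partial>lborel\<bar> \<le> l1norm f"
  unfolding l1norm_def by (rule integral_abs_bound)

lemma l1norm_scale: "l1norm (\<lambda>z. c * f z) = \<bar>c\<bar> * l1norm f"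
  unfolding l1norm_def by (simp add: abs_mult)

lemma l1norm_triangle:
  assumes "L1 f" "L1 g"
  shows "l1norm (\<lambda>z. f z + g z) \<le> l1norm f + l1norm g"
proof -
  have "l1norm (\<lambda>z. f z + g z) \<le> (\<integral>z. \<bar>f z\<bar> + \<bar>g z\<bar> \<partial>lborel)"
    unfolding l1norm_def using assms
    by (intro integral_mono) (auto simp: L1_def abs_triangle_ineq)
  also have "\<dots> = l1norm f + l1norm g"
    unfolding l1norm_def using assms by (intro Bochner_Integration.integral_add) (auto simp: L1_def)
  finally show ?thesis .
qed

lemma l1norm_triangle_diff:
  assumes "L1 f" "L1 g"
  shows "l1norm (\<lambda>z. f z - g z) \<le> l1norm f + l1norm g"
  using l1norm_triangle[OF assms(1) L1_scale[OF assms(2), of "-1"]] l1norm_scale[of "-1" g] by simp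

lemma l1norm_dist_triangle:
  assumes "L1 f" "L1 g" "L1 h"
  shows "l1norm (\<lambda>z. f z - h z) \<le> l1norm (\<lambda>z. f z - g z) + l1norm (\<lambda>z. g z - h z)"
  using l1norm_triangle[OF L1_diff[OF assms(1,2)] L1_diff[OF assms(2,3)]] by simp

lemma l1norm_tendsto_zero_squeeze:
  assumes "\<forall>\<^sub>F x in F. l1norm (f x) \<le> u x" and "(u \<longlongrightarrow> 0) F"
  shows "((\<lambda>x. l1norm (f x)) \<longlongrightarrow> 0) F"
  by (rule tendsto_sandwich[OF _ assms(1) tendsto_const assms(2)]) (simp add: l1norm_nonneg)

section \<open>Generators of contraction semigroups on \<open>L\<^sup>1\<close>\<close>

lemma le_mult_of_local_growth_le:
  fixes a :: "real \<Rightarrow> real"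
  assumes start: "a 0 \<le> 0" and t: "0 \<le> t"
    and growth: "\<And>e. 0 < e \<Longrightarrow> \<exists>r>0. \<forall>u s. 0 \<le> u \<longrightarrow> u + s \<le> t \<longrightarrow> 0 < s \<longrightarrow> s < r
                   \<longrightarrow> a (u + s) \<le> a u + (c + e) * s"
  shows "a t \<le> c * t"
proof (cases "t = 0")
  case False
  with t have t: "0 < t" by simp
  show ?thesis
  proof (rule field_le_epsilon)
    fix e :: real assume "0 < e"
    then obtain r where r: "0 < r" and step: "\<And>u s. 0 \<le> u \<Longrightarrow> u + s \<le> t \<Longrightarrow> 0 < s \<Longrightarrow> s < r
        \<Longrightarrow> a (u + s) \<le> a u + (c + e / t) * s"
      using growth[of "e / t"] t by auto
    obtain N where N: "t / r < real N" using reals_Archimedean2 by blast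
    moreover have "0 < t / r" using t r by simp
    ultimately have N_pos: "0 < real N" by linarith
    define s where "s = t / real N"
    have s: "0 < s" "s < r" "real N * s = t" using N N_pos r t by (auto simp: s_def field_simps)
    have "a (real k * s) \<le> (c + e / t) * (real k * s)" if "k \<le> N" for k
      using that
    proof (induction k)
      case (Suc k)
      have "real k * s + s \<le> real N * s"
        using Suc.prems s(1) mult_right_mono[of "real (Suc k)" "real N" s] by (simp add: algebra_simps)
      then have "a (real k * s + s) \<le> a (real k * s) + (c + e / t) * s"
        using s by (intro step) auto
      with Suc show ?case by (simp add: algebra_simps)
    qed (simp add: start)
    from this[of N] s(3) show "a t \<le> c * t + e" using t by (simp add: algebra_simps)
  qed
qed (use start in simp)

locale contraction_semigroup =
  fixes Z :: "real \<Rightarrow> fn \<Rightarrow> fn"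
  assumes semigroup: "C0_semigroup Z" and contraction: "contraction_sg Z"
begin

lemma L1_Z: "0 \<le> t \<Longrightarrow> L1 f \<Longrightarrow> L1 (Z t f)"
  and Z_linear: "0 \<le> t \<Longrightarrow> L1 f \<Longrightarrow> L1 g \<Longrightarrow>
    aeq (Z t (\<lambda>z. f z + c * g z)) (\<lambda>z. Z t f z + c * Z t g z)"
  and Z_0: "L1 f \<Longrightarrow> aeq (Z 0 f) f"
  and Z_add: "0 \<le> s \<Longrightarrow> 0 \<le> t \<Longrightarrow> L1 f \<Longrightarrow> aeq (Z (s + t) f) (Z s (Z t f))"
  and Z_tendsto: "L1 f \<Longrightarrow> ((\<lambda>t. l1norm (\<lambda>z. Z t f z - f z)) \<longlongrightarrow> 0) (at_right 0)"
  using semigroup unfolding C0_semigroup_def by (elim conjE; simp)+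

lemma l1norm_Z_le: "0 \<le> t \<Longrightarrow> L1 f \<Longrightarrow> l1norm (Z t f) \<le> l1norm f"
  using contraction unfolding contraction_sg_def by blast

lemma Z_diff:
  assumes "0 \<le> t" "L1 f" "L1 g"
  shows "aeq (Z t (\<lambda>z. f z - g z)) (\<lambda>z. Z t f z - Z t g z)"
  using Z_linear[OF assms, of "-1"] by simp

lemma Z_scale:
  assumes "0 \<le> t" "L1 f"
  shows "aeq (Z t (\<lambda>z. c * f z)) (\<lambda>z. c * Z t f z)"
  using Z_linear[OF assms(1,2,2), of "c - 1"] by (simp add: algebra_simps)

lemma l1norm_Z_diff_le:
  assumes "0 \<le> t" "L1 f" "L1 g"
  shows "l1norm (\<lambda>z. Z t f z - Z t g z) \<le> l1norm (\<lambda>z. f z - g z)"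
proof -
  have "l1norm (\<lambda>z. Z t f z - Z t g z) = l1norm (Z t (\<lambda>z. f z - g z))"
    using assms Z_diff[OF assms]
    by (intro l1norm_cong L1_diff L1_Z) (auto simp: aeq_def elim: eventually_mono)
  also have "\<dots> \<le> l1norm (\<lambda>z. f z - g z)"
    using assms by (intro l1norm_Z_le L1_diff)
  finally show ?thesis .
qed

definition taylor_remainder :: "fn \<Rightarrow> fn \<Rightarrow> real \<Rightarrow> fn" where
  "taylor_remainder f g s = (\<lambda>z. Z s f z - f z - s * g z)"

lemma L1_taylor_remainder: "0 \<le> s \<Longrightarrow> L1 f \<Longrightarrow> L1 g \<Longrightarrow> L1 (taylor_remainder f g s)"
  unfolding taylor_remainder_def by (intro L1_intros L1_Z)

lemma l1norm_taylor_remainder_0: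
  assumes "L1 f"
  shows "l1norm (taylor_remainder f g 0) = 0"
proof -
  have "l1norm (taylor_remainder f g 0) = l1norm (\<lambda>z. Z 0 f z - f z)"
    by (simp add: taylor_remainder_def)
  also have "\<dots> = l1norm (\<lambda>z. 0)"
    using Z_0[OF assms] assms
    by (intro l1norm_cong L1_diff L1_Z) (auto simp: aeq_def L1_def elim: eventually_mono)
  finally show ?thesis by (simp add: l1norm_zero)
qed

lemma Z_taylor_remainder:
  assumes "0 \<le> t" "0 \<le> s" "L1 f" "L1 g"
  shows "aeq (Z t (taylor_remainder f g s)) (\<lambda>z. Z (t + s) f z - Z t f z - s * Z t g z)"
proof -
  have in_L1: "L1 (Z s f)" "L1 (\<lambda>z. Z s f z - f z)" using assms by (auto intro!: L1_intros L1_Z)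
  have "aeq (Z t (\<lambda>z. (Z s f z - f z) + (- s) * g z)) (\<lambda>z. Z t (\<lambda>z. Z s f z - f z) z + (- s) * Z t g z)"
    using assms in_L1 by (intro Z_linear) auto
  moreover have "aeq (Z t (\<lambda>z. Z s f z - f z)) (\<lambda>z. Z t (Z s f) z - Z t f z)"
    using assms in_L1 by (intro Z_diff) auto
  moreover have "aeq (Z (t + s) f) (Z t (Z s f))" using assms by (intro Z_add)
  ultimately show ?thesis unfolding aeq_def taylor_remainder_def
    by eventually_elim simp
qed

lemma generator_iff_taylor_remainder:
  "generator Z f g \<longleftrightarrow>
     L1 f \<and> L1 g \<and> ((\<lambda>s. l1norm (taylor_remainder f g s) / s) \<longlongrightarrow> 0) (at_right 0)"
proof -
  have "l1norm (\<lambda>z. (Z s f z - f z) / s - g z) = l1norm (taylor_remainder f g s) / s" if "0 < s" for s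
  proof -
    have "(\<lambda>z. (Z s f z - f z) / s - g z) = (\<lambda>z. (1 / s) * taylor_remainder f g s z)"
      using that by (auto simp: taylor_remainder_def field_simps)
    with that show ?thesis by (simp only: l1norm_scale) simp
  qed
  then have "((\<lambda>s. l1norm (\<lambda>z. (Z s f z - f z) / s - g z)) \<longlongrightarrow> 0) (at_right 0) \<longleftrightarrow>
      ((\<lambda>s. l1norm (taylor_remainder f g s) / s) \<longlongrightarrow> 0) (at_right 0)"
    using eventually_at_right_less[of "0 :: real"] by (intro tendsto_cong) (auto elim: eventually_mono)
  then show ?thesis by (simp add: generator_def)
qed

lemma generator_L1: "generator Z f g \<Longrightarrow> L1 f \<and> L1 g"
  unfolding generator_def by blast

lemma taylor_remainder_small:
  assumes "generator Z f g" "0 < e"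
  shows "\<exists>r>0. \<forall>s. 0 < s \<longrightarrow> s < r \<longrightarrow> l1norm (taylor_remainder f g s) \<le> e * s"
proof -
  have "\<forall>\<^sub>F s in at_right 0. l1norm (taylor_remainder f g s) / s < e"
    using assms order_tendstoD(2) unfolding generator_iff_taylor_remainder by blast
  then show ?thesis
    unfolding eventually_at_right_field by (auto simp: pos_divide_less_eq less_imp_le)
qed

lemma taylor_remainder_add_le:
  assumes "0 \<le> u" "0 \<le> s" "L1 f" "L1 g" "L1 g'"
  shows "l1norm (taylor_remainder f g' (u + s)) \<le> l1norm (taylor_remainder f g' u)
           + l1norm (taylor_remainder f g s)
           + s * (l1norm (\<lambda>z. g z - g' z) + l1norm (\<lambda>z. Z u g' z - g' z))"
proof -
  let ?step = "Z u (taylor_remainder f g s)"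
  let ?source = "\<lambda>z. s * (Z u g z - Z u g' z)" and ?drift = "\<lambda>z. s * (Z u g' z - g' z)"
  have terms_in_L1: "L1 (taylor_remainder f g s)" "L1 (taylor_remainder f g' u)"
      "L1 (taylor_remainder f g' (u + s))" "L1 ?step" "L1 ?source" "L1 ?drift"
    using assms by (auto intro!: L1_taylor_remainder L1_intros L1_Z)
  have "aeq (taylor_remainder f g' (u + s))
      (\<lambda>z. (taylor_remainder f g' u z + ?step z) + (?source z + ?drift z))"
    using Z_taylor_remainder[of u s f g] assms unfolding aeq_def
    by (auto elim!: eventually_mono simp: taylor_remainder_def algebra_simps)
  then have "l1norm (taylor_remainder f g' (u + s))
      = l1norm (\<lambda>z. (taylor_remainder f g' u z + ?step z) + (?source z + ?drift z))"
    using terms_in_L1 by (intro l1norm_cong L1_add)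
  also have "\<dots> \<le> l1norm (\<lambda>z. taylor_remainder f g' u z + ?step z) + l1norm (\<lambda>z. ?source z + ?drift z)"
    using terms_in_L1 by (intro l1norm_triangle L1_add)
  also have "\<dots> \<le> (l1norm (taylor_remainder f g' u) + l1norm ?step) + (l1norm ?source + l1norm ?drift)"
    using terms_in_L1 by (intro add_mono l1norm_triangle)
  also have "l1norm ?step \<le> l1norm (taylor_remainder f g s)"
    using assms(1) terms_in_L1(1) by (rule l1norm_Z_le)
  also have "l1norm ?source \<le> s * l1norm (\<lambda>z. g z - g' z)"
    using l1norm_Z_diff_le[OF assms(1,4,5)] assms(2) by (simp add: l1norm_scale mult_left_mono)
  also have "l1norm ?drift = s * l1norm (\<lambda>z. Z u g' z - g' z)"
    using assms(2) by (simp add: l1norm_scale)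
  finally show ?thesis by (simp add: algebra_simps)
qed

lemma generator_taylor_remainder_le:
  assumes gen: "generator Z f g" and g': "L1 g'" and t: "0 \<le> t"
    and w: "\<And>u. 0 \<le> u \<Longrightarrow> u < t \<Longrightarrow> l1norm (\<lambda>z. Z u g' z - g' z) \<le> w"
  shows "l1norm (taylor_remainder f g' t) \<le> (l1norm (\<lambda>z. g z - g' z) + w) * t"
proof (rule le_mult_of_local_growth_le)
  have in_L1: "L1 f" "L1 g" using gen generator_L1 by auto
  show "l1norm (taylor_remainder f g' 0) \<le> 0" using in_L1 by (simp add: l1norm_taylor_remainder_0)
  fix e :: real assume "0 < e"
  then obtain r where r: "0 < r"
    and rem: "\<And>s. 0 < s \<Longrightarrow> s < r \<Longrightarrow> l1norm (taylor_remainder f g s) \<le> e * s"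
    using taylor_remainder_small[OF gen] by blast
  have "l1norm (taylor_remainder f g' (u + s))
      \<le> l1norm (taylor_remainder f g' u) + (l1norm (\<lambda>z. g z - g' z) + w + e) * s"
    if u: "0 \<le> u" "u + s \<le> t" and s: "0 < s" "s < r" for u s
  proof -
    have "l1norm (taylor_remainder f g' (u + s)) \<le> l1norm (taylor_remainder f g' u)
        + l1norm (taylor_remainder f g s)
        + s * (l1norm (\<lambda>z. g z - g' z) + l1norm (\<lambda>z. Z u g' z - g' z))"
      using in_L1 g' u s by (intro taylor_remainder_add_le) auto
    also have "\<dots> \<le> l1norm (taylor_remainder f g' u) + e * s + s * (l1norm (\<lambda>z. g z - g' z) + w)"
      using rem[OF s] w[of u] u s by (intro add_mono mult_left_mono order_refl) auto
    finally show ?thesis by (simp add: algebra_simps)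
  qed
  with r show "\<exists>r>0. \<forall>u s. 0 \<le> u \<longrightarrow> u + s \<le> t \<longrightarrow> 0 < s \<longrightarrow> s < r \<longrightarrow> l1norm (taylor_remainder f g' (u + s))
      \<le> l1norm (taylor_remainder f g' u) + (l1norm (\<lambda>z. g z - g' z) + w + e) * s"
    by blast
qed (rule t)

lemma taylor_remainder_dist_le:
  assumes "0 \<le> t" "L1 f" "L1 f'" "L1 g"
  shows "l1norm (taylor_remainder f g t)
      \<le> l1norm (taylor_remainder f' g t) + 2 * l1norm (\<lambda>z. f' z - f z)"
proof -
  have terms_in_L1: "L1 (taylor_remainder f' g t)" "L1 (\<lambda>z. Z t f' z - Z t f z)" "L1 (\<lambda>z. f' z - f z)"
    using assms by (auto intro!: L1_taylor_remainder L1_intros L1_Z)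
  have "l1norm (taylor_remainder f g t)
      = l1norm (\<lambda>z. taylor_remainder f' g t z - ((Z t f' z - Z t f z) - (f' z - f z)))"
    by (simp add: taylor_remainder_def algebra_simps)
  also have "\<dots> \<le> l1norm (taylor_remainder f' g t) + l1norm (\<lambda>z. (Z t f' z - Z t f z) - (f' z - f z))"
    by (rule l1norm_triangle_diff[OF terms_in_L1(1) L1_diff[OF terms_in_L1(2,3)]])
  also have "l1norm (\<lambda>z. (Z t f' z - Z t f z) - (f' z - f z))
      \<le> l1norm (\<lambda>z. Z t f' z - Z t f z) + l1norm (\<lambda>z. f' z - f z)"
    by (rule l1norm_triangle_diff[OF terms_in_L1(2,3)])
  also have "l1norm (\<lambda>z. Z t f' z - Z t f z) \<le> l1norm (\<lambda>z. f' z - f z)"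
    using assms by (intro l1norm_Z_diff_le)
  finally show ?thesis by simp
qed

lemma taylor_remainder_limit_le:
  assumes gen: "\<And>n. generator Z (fs n) (gs n)" and "L1 f" "L1 g"
    and f: "(\<lambda>n. l1norm (\<lambda>z. fs n z - f z)) \<longlonglongrightarrow> 0"
    and g: "(\<lambda>n. l1norm (\<lambda>z. gs n z - g z)) \<longlonglongrightarrow> 0"
    and t: "0 \<le> t" and w: "\<And>u. 0 \<le> u \<Longrightarrow> u < t \<Longrightarrow> l1norm (\<lambda>z. Z u g z - g z) \<le> w"
  shows "l1norm (taylor_remainder f g t) \<le> w * t"
proof -
  let ?b = "\<lambda>n. (l1norm (\<lambda>z. gs n z - g z) + w) * t + 2 * l1norm (\<lambda>z. fs n z - f z)"
  have "l1norm (taylor_remainder f g t) \<le> ?b n" for n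
  proof -
    have "l1norm (taylor_remainder f g t)
        \<le> l1norm (taylor_remainder (fs n) g t) + 2 * l1norm (\<lambda>z. fs n z - f z)"
      using t \<open>L1 f\<close> \<open>L1 g\<close> generator_L1[OF gen] by (intro taylor_remainder_dist_le) auto
    with generator_taylor_remainder_le[OF gen \<open>L1 g\<close> t w, of n] show ?thesis by linarith
  qed
  moreover have "?b \<longlonglongrightarrow> (0 + w) * t + 2 * 0" by (intro tendsto_intros f g)
  ultimately have "l1norm (taylor_remainder f g t) \<le> (0 + w) * t + 2 * 0"
    by (intro LIMSEQ_le_const) auto
  then show ?thesis by simp
qed

lemma generator_closed:
  assumes gen: "\<And>n. generator Z (fs n) (gs n)" and "L1 f" "L1 g"
    and f: "(\<lambda>n. l1norm (\<lambda>z. fs n z - f z)) \<longlonglongrightarrow> 0"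
    and g: "(\<lambda>n. l1norm (\<lambda>z. gs n z - g z)) \<longlonglongrightarrow> 0"
  shows "generator Z f g"
proof -
  have "((\<lambda>s. l1norm (taylor_remainder f g s) / s) \<longlongrightarrow> 0) (at_right 0)"
  proof (rule tendstoI)
    fix e :: real assume e: "0 < e"
    have "\<forall>\<^sub>F u in at_right 0. l1norm (\<lambda>z. Z u g z - g z) < e / 2"
      using Z_tendsto[OF \<open>L1 g\<close>] e by (intro order_tendstoD) auto
    then obtain r where r: "0 < r" "\<And>u. 0 < u \<Longrightarrow> u < r \<Longrightarrow> l1norm (\<lambda>z. Z u g z - g z) < e / 2"
      unfolding eventually_at_right_field by auto
    have near_0: "l1norm (\<lambda>z. Z u g z - g z) \<le> e / 2" if "0 \<le> u" "u < r" for u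
      using r(2)[of u] that e l1norm_taylor_remainder_0[OF \<open>L1 g\<close>, of g]
      by (cases "u = 0") (auto simp: taylor_remainder_def)
    have "l1norm (taylor_remainder f g s) \<le> (e / 2) * s" if "0 < s" "s < r" for s
      using that by (intro taylor_remainder_limit_le[OF gen \<open>L1 f\<close> \<open>L1 g\<close> f g] near_0) auto
    then have "dist (l1norm (taylor_remainder f g s) / s) 0 < e" if "0 < s" "s < r" for s
      using that e le_less_trans[of "l1norm (taylor_remainder f g s)" "(e / 2) * s" "e * s"]
      by (simp add: l1norm_nonneg pos_divide_less_eq)
    then show "\<forall>\<^sub>F s in at_right 0. dist (l1norm (taylor_remainder f g s) / s) 0 < e"
      using r(1) unfolding eventually_at_right_field by blast
  qed
  with \<open>L1 f\<close> \<open>L1 g\<close> show ?thesis by (simp add: generator_iff_taylor_remainder)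
qed

lemma generatorI_taylor_remainder_le:
  assumes "L1 f" "L1 g" and "\<And>s. 0 < s \<Longrightarrow> l1norm (taylor_remainder f g s) \<le> b s"
    and "((\<lambda>s. b s / s) \<longlongrightarrow> 0) (at_right 0)"
  shows "generator Z f g"
proof -
  have "\<forall>\<^sub>F s in at_right 0. l1norm (taylor_remainder f g s) / s \<le> b s / s"
    using eventually_at_right_less[of "0 :: real"]
    by eventually_elim (use assms(3) in \<open>simp add: divide_right_mono\<close>)
  moreover have "\<forall>\<^sub>F s in at_right 0. 0 \<le> l1norm (taylor_remainder f g s) / s"
    using eventually_at_right_less[of "0 :: real"] by eventually_elim (simp add: l1norm_nonneg)
  ultimately have "((\<lambda>s. l1norm (taylor_remainder f g s) / s) \<longlongrightarrow> 0) (at_right 0)"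
    using assms(4) by (auto intro: tendsto_sandwich[OF _ _ tendsto_const])
  with assms show ?thesis by (simp add: generator_iff_taylor_remainder)
qed

lemma generator_diff:
  assumes gen: "generator Z f g" "generator Z f' g'"
  shows "generator Z (\<lambda>z. f z - f' z) (\<lambda>z. g z - g' z)"
proof (rule generatorI_taylor_remainder_le)
  have in_L1: "L1 f" "L1 g" "L1 f'" "L1 g'" using gen generator_L1 by auto
  then show "L1 (\<lambda>z. f z - f' z)" "L1 (\<lambda>z. g z - g' z)" by (auto intro: L1_diff)
  show "((\<lambda>s. (l1norm (taylor_remainder f g s) + l1norm (taylor_remainder f' g' s)) / s)
      \<longlongrightarrow> 0) (at_right 0)"
    using gen unfolding generator_iff_taylor_remainder add_divide_distrib
    by (auto intro!: tendsto_add_zero)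
  show "l1norm (taylor_remainder (\<lambda>z. f z - f' z) (\<lambda>z. g z - g' z) s)
      \<le> l1norm (taylor_remainder f g s) + l1norm (taylor_remainder f' g' s)" if s: "0 < s" for s
  proof -
    have terms_in_L1: "L1 (taylor_remainder f g s)" "L1 (taylor_remainder f' g' s)"
        "L1 (taylor_remainder (\<lambda>z. f z - f' z) (\<lambda>z. g z - g' z) s)"
      using in_L1 s by (auto intro!: L1_taylor_remainder L1_diff)
    have "aeq (taylor_remainder (\<lambda>z. f z - f' z) (\<lambda>z. g z - g' z) s)
        (\<lambda>z. taylor_remainder f g s z - taylor_remainder f' g' s z)"
      using Z_diff[of s f f'] in_L1 s unfolding aeq_def
      by (auto elim!: eventually_mono simp: taylor_remainder_def algebra_simps)
    then have "l1norm (taylor_remainder (\<lambda>z. f z - f' z) (\<lambda>z. g z - g' z) s)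
        = l1norm (\<lambda>z. taylor_remainder f g s z - taylor_remainder f' g' s z)"
      using terms_in_L1 by (intro l1norm_cong L1_diff)
    also have "\<dots> \<le> l1norm (taylor_remainder f g s) + l1norm (taylor_remainder f' g' s)"
      using terms_in_L1 by (intro l1norm_triangle_diff)
    finally show ?thesis .
  qed
qed

lemma generator_Z:
  assumes gen: "generator Z f g" and t: "0 \<le> t"
  shows "generator Z (Z t f) (Z t g)"
proof (rule generatorI_taylor_remainder_le)
  have in_L1: "L1 f" "L1 g" using gen generator_L1 by auto
  with t show "L1 (Z t f)" "L1 (Z t g)" by (auto intro: L1_Z)
  show "((\<lambda>s. l1norm (taylor_remainder f g s) / s) \<longlongrightarrow> 0) (at_right 0)"
    using gen by (simp add: generator_iff_taylor_remainder)
  show "l1norm (taylor_remainder (Z t f) (Z t g) s) \<le> l1norm (taylor_remainder f g s)"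
    if s: "0 < s" for s
  proof -
    have terms_in_L1: "L1 (taylor_remainder f g s)" using in_L1 s by (intro L1_taylor_remainder) auto
    have "aeq (Z (s + t) f) (Z s (Z t f))" using s t in_L1 by (intro Z_add) auto
    with Z_taylor_remainder[of t s f g]
    have "aeq (taylor_remainder (Z t f) (Z t g) s) (Z t (taylor_remainder f g s))"
      using s t in_L1 unfolding aeq_def
      by (auto elim!: eventually_elim2 simp: taylor_remainder_def add.commute)
    then have "l1norm (taylor_remainder (Z t f) (Z t g) s) = l1norm (Z t (taylor_remainder f g s))"
      using s t in_L1 terms_in_L1 by (intro l1norm_cong L1_taylor_remainder L1_Z) auto
    also have "\<dots> \<le> l1norm (taylor_remainder f g s)"
      using t terms_in_L1 by (rule l1norm_Z_le)
    finally show ?thesis .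
  qed
qed

lemma generator_dissipative:
  assumes gen: "generator Z f g" and lam: "0 < lam"
  shows "lam * l1norm f \<le> l1norm (\<lambda>z. lam * f z - g z)"
proof (rule tendsto_lowerbound)
  have in_L1: "L1 f" "L1 g" using gen generator_L1 by auto
  have "((\<lambda>s. l1norm (\<lambda>z. lam * f z - g z) + l1norm (taylor_remainder f g s) / s)
      \<longlongrightarrow> l1norm (\<lambda>z. lam * f z - g z) + 0) (at_right 0)"
    using gen unfolding generator_iff_taylor_remainder by (intro tendsto_intros) auto
  then show "((\<lambda>s. l1norm (\<lambda>z. lam * f z - g z) + l1norm (taylor_remainder f g s) / s)
      \<longlongrightarrow> l1norm (\<lambda>z. lam * f z - g z)) (at_right 0)" by simp
  have "lam * l1norm f \<le> l1norm (\<lambda>z. lam * f z - g z) + l1norm (taylor_remainder f g s) / s"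
    if s: "0 < s" for s
  proof -
    let ?h = "\<lambda>z. s * (lam * f z - g z)"
    have terms_in_L1: "L1 ?h" "L1 (Z s f)" "L1 (taylor_remainder f g s)"
      using s in_L1 by (auto intro!: L1_intros L1_Z L1_taylor_remainder)
    have "(1 + s * lam) * l1norm f = l1norm (\<lambda>z. (?h z + Z s f z) - taylor_remainder f g s z)"
      using s lam l1norm_scale[of "1 + s * lam" f] by (simp add: taylor_remainder_def algebra_simps)
    also have "\<dots> \<le> (l1norm ?h + l1norm (Z s f)) + l1norm (taylor_remainder f g s)"
      using terms_in_L1
      by (intro order_trans[OF l1norm_triangle_diff] add_right_mono l1norm_triangle L1_add)
    also have "l1norm (Z s f) \<le> l1norm f" using s in_L1 by (intro l1norm_Z_le) auto
    also have "l1norm ?h = s * l1norm (\<lambda>z. lam * f z - g z)" using s by (simp add: l1norm_scale)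
    finally show ?thesis using s by (simp add: field_simps)
  qed
  then show "\<forall>\<^sub>F s in at_right 0.
      lam * l1norm f \<le> l1norm (\<lambda>z. lam * f z - g z) + l1norm (taylor_remainder f g s) / s"
    using eventually_at_right_less[of "0 :: real"] by (auto elim: eventually_mono)
qed simp

lemma generator_graph_dist_le:
  assumes gen: "generator Z f g" "generator Z f' g'" and lam: "0 < lam"
  defines "e \<equiv> l1norm (\<lambda>z. (lam * f z - g z) - (lam * f' z - g' z))"
  shows "l1norm (\<lambda>z. f z - f' z) \<le> e / lam" and "l1norm (\<lambda>z. g z - g' z) \<le> 2 * e"
proof -
  have in_L1: "L1 f" "L1 g" "L1 f'" "L1 g'" using gen generator_L1 by auto
  have f_le: "lam * l1norm (\<lambda>z. f z - f' z) \<le> e"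
    using generator_dissipative[OF generator_diff[OF gen] lam] unfolding e_def
    by (simp add: algebra_simps)
  then show "l1norm (\<lambda>z. f z - f' z) \<le> e / lam" using lam by (simp add: field_simps)
  have "l1norm (\<lambda>z. g z - g' z)
      = l1norm (\<lambda>z. lam * (f z - f' z) - ((lam * f z - g z) - (lam * f' z - g' z)))"
    by (simp add: algebra_simps)
  also have "\<dots> \<le> l1norm (\<lambda>z. lam * (f z - f' z)) + e"
    unfolding e_def using in_L1 by (intro l1norm_triangle_diff L1_intros)
  also have "l1norm (\<lambda>z. lam * (f z - f' z)) \<le> e" using f_le lam by (simp add: l1norm_scale)
  finally show "l1norm (\<lambda>z. g z - g' z) \<le> 2 * e" by simp
qed

lemma integral_Z_on_domain:
  assumes gen: "generator Z f g" and t: "0 \<le> t"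
    and null: "\<And>f g. generator Z f g \<Longrightarrow> (\<integral>z. g z \<partial>lborel) = 0"
  shows "(\<integral>z. Z t f z \<partial>lborel) = (\<integral>z. f z \<partial>lborel)"
proof -
  have in_L1: "L1 f" "L1 g" using gen generator_L1 by auto
  let ?mass = "\<lambda>u. \<integral>z. Z u f z \<partial>lborel"
  have "\<bar>?mass t - ?mass 0\<bar> \<le> 0 * t"
  proof (rule le_mult_of_local_growth_le[of "\<lambda>u. \<bar>?mass u - ?mass 0\<bar>"])
    fix e :: real assume "0 < e"
    then obtain r where r: "0 < r"
      and rem: "\<And>s. 0 < s \<Longrightarrow> s < r \<Longrightarrow> l1norm (taylor_remainder f g s) \<le> e * s"
      using taylor_remainder_small[OF gen] by blast
    have "\<bar>?mass (u + s) - ?mass 0\<bar> \<le> \<bar>?mass u - ?mass 0\<bar> + (0 + e) * s"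
      if u: "0 \<le> u" and s: "0 < s" "s < r" for u s
    proof -
      have remainder_in_L1: "L1 (taylor_remainder f g s)"
        using in_L1 s by (intro L1_taylor_remainder) auto
      have terms_in_L1: "L1 (Z (u + s) f)" "L1 (Z u f)" "L1 (Z u g)" "L1 (Z u (taylor_remainder f g s))"
        using in_L1 remainder_in_L1 u s by (auto intro: L1_Z)
      have "(\<integral>z. Z u (taylor_remainder f g s) z \<partial>lborel)
          = (\<integral>z. Z (u + s) f z - Z u f z - s * Z u g z \<partial>lborel)"
        using in_L1 terms_in_L1 u s by (intro integral_cong_aeq Z_taylor_remainder L1_intros) auto
      also have "\<dots> = ?mass (u + s) - ?mass u"
        using terms_in_L1 null[OF generator_Z[OF gen u]] by (simp add: L1_def)
      finally have "\<bar>?mass (u + s) - ?mass u\<bar> \<le> l1norm (Z u (taylor_remainder f g s))"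
        using abs_integral_le_l1norm[of "Z u (taylor_remainder f g s)"] by simp
      also have "\<dots> \<le> e * s" using l1norm_Z_le[OF u remainder_in_L1] rem[OF s] by linarith
      finally show ?thesis by simp
    qed
    with r show "\<exists>r>0. \<forall>u s. 0 \<le> u \<longrightarrow> u + s \<le> t \<longrightarrow> 0 < s \<longrightarrow> s < r
        \<longrightarrow> \<bar>?mass (u + s) - ?mass 0\<bar> \<le> \<bar>?mass u - ?mass 0\<bar> + (0 + e) * s" by blast
  qed (use t in simp_all)
  moreover have "?mass 0 = (\<integral>z. f z \<partial>lborel)"
    using Z_0[OF in_L1(1)] in_L1 by (intro integral_cong_aeq L1_Z) auto
  ultimately show ?thesis by simp
qed

end

definition range_closure :: "real \<Rightarrow> (fn \<Rightarrow> fn \<Rightarrow> bool) \<Rightarrow> fn \<Rightarrow> bool" where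
  "range_closure lam R h \<longleftrightarrow> (\<forall>d>0. \<exists>f g. R f g \<and> l1norm (\<lambda>z. lam * f z - g z - h z) < d)"

definition linear_op :: "(fn \<Rightarrow> fn \<Rightarrow> bool) \<Rightarrow> bool" where
  "linear_op R \<longleftrightarrow> (\<forall>f g. R f g \<longrightarrow> L1 f \<and> L1 g) \<and>
     (\<forall>f g f' g' c. R f g \<longrightarrow> R f' g' \<longrightarrow> R (\<lambda>z. f z + c * f' z) (\<lambda>z. g z + c * g' z))"

lemma range_closure_diff:
  assumes R: "linear_op R" and in_L1: "L1 h" "L1 h'"
    and h: "range_closure lam R h" and h': "range_closure lam R h'"
  shows "range_closure lam R (\<lambda>z. h z - h' z)"
  unfolding range_closure_def
proof (intro allI impI)
  fix d :: real assume "0 < d"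
  then have d: "0 < d / 2" by simp
  from h d obtain f g where fg: "R f g" "l1norm (\<lambda>z. lam * f z - g z - h z) < d / 2"
    unfolding range_closure_def by blast
  from h' d obtain f' g' where fg': "R f' g'" "l1norm (\<lambda>z. lam * f' z - g' z - h' z) < d / 2"
    unfolding range_closure_def by blast
  let ?f = "\<lambda>z. f z + (-1) * f' z" and ?g = "\<lambda>z. g z + (-1) * g' z"
  have "L1 f" "L1 g" "L1 f'" "L1 g'" using R fg(1) fg'(1) unfolding linear_op_def by blast+
  then have "l1norm (\<lambda>z. (lam * f z - g z - h z) - (lam * f' z - g' z - h' z)) < d"
    using in_L1 fg(2) fg'(2) by (intro le_less_trans[OF l1norm_triangle_diff]) (auto intro!: L1_intros)
  also have "(\<lambda>z. (lam * f z - g z - h z) - (lam * f' z - g' z - h' z))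
      = (\<lambda>z. lam * ?f z - ?g z - (h z - h' z))"
    by (simp add: algebra_simps)
  finally show "\<exists>f g. R f g \<and> l1norm (\<lambda>z. lam * f z - g z - (h z - h' z)) < d"
    using R fg(1) fg'(1) unfolding linear_op_def by blast
qed

lemma range_closure_closed:
  assumes R: "linear_op R" and in_L1: "\<And>n. L1 (hs n)" "L1 h"
    and hs: "\<And>n. range_closure lam R (hs n)" and lim: "(\<lambda>n. l1norm (\<lambda>z. hs n z - h z)) \<longlonglongrightarrow> 0"
  shows "range_closure lam R h"
  unfolding range_closure_def
proof (intro allI impI)
  fix d :: real assume "0 < d"
  then have d: "0 < d / 2" by simp
  with lim obtain n where n: "l1norm (\<lambda>z. hs n z - h z) < d / 2"
    using order_tendstoD(2)[OF lim d] by (auto simp: eventually_sequentially)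
  from hs[of n] d obtain f g where fg: "R f g" "l1norm (\<lambda>z. lam * f z - g z - hs n z) < d / 2"
    unfolding range_closure_def by blast
  then have "L1 f" "L1 g" using R unfolding linear_op_def by blast+
  then have "l1norm (\<lambda>z. lam * f z - g z - h z) < d"
    using n fg(2) in_L1
    by (intro le_less_trans[OF l1norm_dist_triangle[of _ "hs n"]]) (auto intro!: L1_intros)
  with fg(1) show "\<exists>f g. R f g \<and> l1norm (\<lambda>z. lam * f z - g z - h z) < d" by blast
qed

context contraction_semigroup
begin

lemma generator_imp_op_closure:
  assumes ext: "extends_op (generator Z) R" and lam: "0 < lam"
    and dense: "\<And>h. L1 h \<Longrightarrow> range_closure lam R h" and gen: "generator Z f g"
  shows "op_closure R f g"
proof -
  have in_L1: "L1 f" "L1 g" using gen generator_L1 by auto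
  let ?e = "\<lambda>f' g'. l1norm (\<lambda>z. (lam * f' z - g' z) - (lam * f z - g z))"
  have "\<exists>f' g'. R f' g' \<and> ?e f' g' < inverse (real (Suc n))" for n
    using dense[OF L1_diff[OF L1_scale[OF in_L1(1)] in_L1(2)]] unfolding range_closure_def by simp
  then have "\<forall>n. \<exists>f'. \<exists>g'. R f' g' \<and> ?e f' g' < inverse (real (Suc n))" ..
  then obtain fs where "\<forall>n. \<exists>g'. R (fs n) g' \<and> ?e (fs n) g' < inverse (real (Suc n))"
    by (rule choice[THEN exE])
  then obtain gs where "\<forall>n. R (fs n) (gs n) \<and> ?e (fs n) (gs n) < inverse (real (Suc n))"
    by (rule choice[THEN exE])
  then have R: "R (fs n) (gs n)" and e_le: "?e (fs n) (gs n) < inverse (real (Suc n))" for n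
    by auto
  have gen_n: "generator Z (fs n) (gs n)" for n using ext R unfolding extends_op_def by blast
  have e: "(\<lambda>n. ?e (fs n) (gs n)) \<longlonglongrightarrow> 0"
    using e_le by (intro l1norm_tendsto_zero_squeeze[OF _ LIMSEQ_inverse_real_of_nat])
      (simp add: less_imp_le)
  have "(\<lambda>n. l1norm (\<lambda>z. fs n z - f z)) \<longlonglongrightarrow> 0"
    by (rule l1norm_tendsto_zero_squeeze[OF _ tendsto_divide_zero[OF e, of lam]])
      (simp add: generator_graph_dist_le(1)[OF gen_n gen lam])
  moreover have "(\<lambda>n. l1norm (\<lambda>z. gs n z - g z)) \<longlonglongrightarrow> 0"
    by (rule l1norm_tendsto_zero_squeeze[OF _ tendsto_mult_right_zero[OF e, of 2]])
      (simp add: generator_graph_dist_le(2)[OF gen_n gen lam])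
  ultimately show ?thesis using in_L1 R unfolding op_closure_def by blast
qed

theorem generator_eq_op_closure:
  assumes ext: "extends_op (generator Z) R" and core: "extends_op R R'" and lam: "0 < lam"
    and dense: "\<And>h. L1 h \<Longrightarrow> range_closure lam R' h"
  shows "generator Z f g \<longleftrightarrow> op_closure R f g"
proof
  assume "generator Z f g"
  moreover have "extends_op (generator Z) R'" using ext core unfolding extends_op_def by blast
  ultimately have "op_closure R' f g" using lam dense by (intro generator_imp_op_closure)
  then show "op_closure R f g" using core unfolding op_closure_def extends_op_def by blast
next
  assume "op_closure R f g"
  then show "generator Z f g"
    using ext unfolding op_closure_def extends_op_def by (auto intro: generator_closed)
qed

lemma op_closure_integral_eq_0:
  assumes ext: "extends_op (generator Z) R" and null: "\<And>f g. R f g \<Longrightarrow> (\<integral>z. g z \<partial>lborel) = 0"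
    and closure: "op_closure R f g"
  shows "(\<integral>z. g z \<partial>lborel) = 0"
proof -
  obtain fs gs where fg: "\<And>n. R (fs n) (gs n)" and in_L1: "L1 g"
    and lim: "(\<lambda>n. l1norm (\<lambda>z. gs n z - g z)) \<longlonglongrightarrow> 0" using closure unfolding op_closure_def by blast
  have "\<bar>\<integral>z. g z \<partial>lborel\<bar> \<le> l1norm (\<lambda>z. gs n z - g z)" for n
  proof -
    have "L1 (gs n)" using ext fg generator_L1 unfolding extends_op_def by blast
    then show ?thesis
      using abs_integral_le_l1norm[of "\<lambda>z. gs n z - g z"] null[OF fg[of n]] in_L1
      by (simp add: integral_L1_diff)
  qed
  then have "\<bar>\<integral>z. g z \<partial>lborel\<bar> \<le> 0" by (intro LIMSEQ_le_const[OF lim]) auto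
  then show ?thesis by simp
qed

lemma integral_Z_shifted_range:
  assumes gen: "generator Z f g" and t: "0 \<le> t"
    and null: "\<And>f g. generator Z f g \<Longrightarrow> (\<integral>z. g z \<partial>lborel) = 0"
  shows "(\<integral>z. Z t (\<lambda>z. lam * f z - g z) z \<partial>lborel) = (\<integral>z. lam * f z - g z \<partial>lborel)"
proof -
  have in_L1: "L1 f" "L1 g" using generator_L1[OF gen] by auto
  then have terms_in_L1: "L1 (\<lambda>z. lam * f z)" "L1 (\<lambda>z. lam * f z - g z)" "L1 (Z t f)" "L1 (Z t g)"
      "L1 (Z t (\<lambda>z. lam * f z - g z))"
    using t by (auto intro!: L1_intros L1_Z)
  have "aeq (Z t (\<lambda>z. lam * f z - g z)) (\<lambda>z. lam * Z t f z - Z t g z)"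
    using Z_diff[OF t terms_in_L1(1) in_L1(2)] Z_scale[OF t in_L1(1), of lam]
    unfolding aeq_def by eventually_elim simp
  then have "(\<integral>z. Z t (\<lambda>z. lam * f z - g z) z \<partial>lborel) = (\<integral>z. lam * Z t f z - Z t g z \<partial>lborel)"
    using terms_in_L1 by (intro integral_cong_aeq L1_intros)
  also have "\<dots> = lam * (\<integral>z. Z t f z \<partial>lborel) - (\<integral>z. Z t g z \<partial>lborel)"
    using terms_in_L1 by (simp add: L1_def)
  also have "\<dots> = lam * (\<integral>z. f z \<partial>lborel) - (\<integral>z. g z \<partial>lborel)"
    using integral_Z_on_domain[OF gen t null] null[OF gen] null[OF generator_Z[OF gen t]] by simp
  also have "\<dots> = (\<integral>z. lam * f z - g z \<partial>lborel)"
    using in_L1 by (simp add: L1_def)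
  finally show ?thesis .
qed

theorem integral_Z_eq:
  assumes ext: "extends_op (generator Z) R" and lam: "0 < lam"
    and dense: "\<And>h. L1 h \<Longrightarrow> range_closure lam R h" and null: "\<And>f g. R f g \<Longrightarrow> (\<integral>z. g z \<partial>lborel) = 0"
    and t: "0 \<le> t" and h: "L1 h"
  shows "(\<integral>z. Z t h z \<partial>lborel) = (\<integral>z. h z \<partial>lborel)"
proof -
  have null_gen: "(\<integral>z. g z \<partial>lborel) = 0" if "generator Z f g" for f g
    using op_closure_integral_eq_0[OF ext null generator_imp_op_closure[OF ext lam dense that]] .
  have "\<bar>(\<integral>z. Z t h z \<partial>lborel) - (\<integral>z. h z \<partial>lborel)\<bar> \<le> 0"
  proof (rule field_le_epsilon)
    fix e :: real assume "0 < e"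
    then obtain f g where fg: "R f g" "l1norm (\<lambda>z. lam * f z - g z - h z) < e / 2"
      using dense[OF h] unfolding range_closure_def by (meson half_gt_zero)
    have gen: "generator Z f g" using ext fg(1) unfolding extends_op_def by blast
    let ?h = "\<lambda>z. lam * f z - g z"
    have terms_in_L1: "L1 ?h" "L1 (Z t ?h)" "L1 (Z t h)"
      using generator_L1[OF gen] h t by (auto intro!: L1_intros L1_Z)
    have range_conserved: "(\<integral>z. Z t ?h z \<partial>lborel) = (\<integral>z. ?h z \<partial>lborel)"
      by (rule integral_Z_shifted_range[OF gen t]) (rule null_gen)
    have "\<bar>(\<integral>z. Z t ?h z \<partial>lborel) - (\<integral>z. Z t h z \<partial>lborel)\<bar> \<le> l1norm (\<lambda>z. Z t ?h z - Z t h z)"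
      using abs_integral_le_l1norm[of "\<lambda>z. Z t ?h z - Z t h z"] terms_in_L1
      by (simp add: integral_L1_diff)
    also have "\<dots> \<le> l1norm (\<lambda>z. ?h z - h z)" using t terms_in_L1(1) h by (rule l1norm_Z_diff_le)
    finally have "\<bar>(\<integral>z. Z t ?h z \<partial>lborel) - (\<integral>z. Z t h z \<partial>lborel)\<bar> < e / 2" using fg(2) by simp
    moreover have "\<bar>(\<integral>z. ?h z \<partial>lborel) - (\<integral>z. h z \<partial>lborel)\<bar> < e / 2"
      using abs_integral_le_l1norm[of "\<lambda>z. ?h z - h z"] integral_L1_diff[OF terms_in_L1(1) h] fg(2)
      by simp
    ultimately show "\<bar>(\<integral>z. Z t h z \<partial>lborel) - (\<integral>z. h z \<partial>lborel)\<bar> \<le> 0 + e"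
      using range_conserved by linarith
  qed
  then show ?thesis by simp
qed

end

section \<open>Linear changes of variables\<close>

lemma nn_integral_lborel_translate:
  fixes f :: "'a :: euclidean_space \<Rightarrow> ennreal"
  assumes [measurable]: "f \<in> borel_measurable borel"
  shows "(\<integral>\<^sup>+x. f (x + c) \<partial>lborel) = (\<integral>\<^sup>+x. f x \<partial>lborel)"
proof -
  have "(\<integral>\<^sup>+x. f x \<partial>lborel) = (\<integral>\<^sup>+x. f x \<partial>distr lborel borel ((+) c))"
    by (simp add: lborel_distr_plus)
  also have "\<dots> = (\<integral>\<^sup>+x. f (x + c) \<partial>lborel)"
    by (subst nn_integral_distr) (auto simp: add.commute)
  finally show ?thesis by simp
qed

lemma linear_borel_measurable:
  fixes L :: "'a::euclidean_space \<Rightarrow> 'b::euclidean_space"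
  assumes "linear L"
  shows "L \<in> borel_measurable borel"
  using assms by (intro borel_measurable_continuous_onI linear_continuous_on)
    (simp add: linear_conv_bounded_linear)

lemma lborel_eq_density_distr_linear:
  fixes L :: "real^'n::{finite,wellorder} \<Rightarrow> real^'n::_"
  assumes linear: "linear L" and det: "det (matrix L) \<noteq> 0"
  shows "lborel = density (distr lborel borel L) (\<lambda>_. ennreal \<bar>det (matrix L)\<bar>)"
proof (rule lborel_eqI)
  have L_measurable: "L \<in> borel_measurable borel"
    using linear by (rule linear_borel_measurable)
  have "inj L" using det_nz_iff_inj[OF linear] det by simp
  then obtain L' where inverse: "linear L'" "\<And>x. L' (L x) = x" "\<And>x. L (L' x) = x"
    using linear_injective_isomorphism[OF linear] by blast
  have "matrix L ** matrix L' = mat 1"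
    using matrix_compose[OF inverse(1) linear] inverse(3)
    by (simp add: o_def matrix_id_mat_1[unfolded id_def])
  then have det_inverse: "det (matrix L) * det (matrix L') = 1" by (metis det_mul det_I)
  fix l u :: "real^'n::_" assume le: "\<And>b. b \<in> Basis \<Longrightarrow> l \<bullet> b \<le> u \<bullet> b"
  have preimage: "L -` box l u = L' ` box l u"
    using inverse(2,3) by (force intro: image_eqI[of _ _ "L x" for x])
  have image_measurable: "L' ` box l u \<in> lmeasurable"
    by (rule measurable_linear_image[OF inverse(1)]) simp
  have "emeasure lborel (L -` box l u) = emeasure lebesgue (L' ` box l u)"
    using measurable_sets[OF L_measurable, of "box l u"] unfolding preimage by simp
  also have "\<dots> = ennreal (\<bar>det (matrix L')\<bar> * measure lborel (box l u))"
    using measure_linear_image[OF inverse(1), of "box l u"]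
    by (simp add: emeasure_eq_measure2[OF image_measurable])
  finally have "emeasure (density (distr lborel borel L) (\<lambda>_. ennreal \<bar>det (matrix L)\<bar>)) (box l u)
      = ennreal \<bar>det (matrix L)\<bar> * ennreal (\<bar>det (matrix L')\<bar> * measure lborel (box l u))"
    using L_measurable by (simp add: emeasure_density_const emeasure_distr)
  also have "\<dots> = ennreal (\<bar>det (matrix L) * det (matrix L')\<bar> * measure lborel (box l u))"
    by (simp add: ennreal_mult[symmetric] abs_mult mult.assoc)
  also have "\<dots> = (\<Prod>b\<in>Basis. (u - l) \<bullet> b)"
    using le by (simp add: det_inverse measure_lborel_box_eq)
  finally show "emeasure (density (distr lborel borel L) (\<lambda>_. ennreal \<bar>det (matrix L)\<bar>)) (box l u)
      = (\<Prod>b\<in>Basis. (u - l) \<bullet> b)" .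
qed simp

lemma nn_integral_lborel_linear:
  fixes L :: "real^'n::{finite,wellorder} \<Rightarrow> real^'n::_"
  assumes linear: "linear L" and det: "det (matrix L) \<noteq> 0"
    and f[measurable]: "f \<in> borel_measurable borel"
  shows "(\<integral>\<^sup>+x. f (L x) \<partial>lborel) = ennreal (1 / \<bar>det (matrix L)\<bar>) * (\<integral>\<^sup>+x. f x \<partial>lborel)"
proof -
  have [measurable]: "L \<in> borel_measurable borel"
    using linear by (rule linear_borel_measurable)
  have "(\<integral>\<^sup>+x. f x \<partial>lborel)
      = (\<integral>\<^sup>+x. f x \<partial>density (distr lborel borel L) (\<lambda>_. ennreal \<bar>det (matrix L)\<bar>))"
    using lborel_eq_density_distr_linear[OF linear det] by simp
  also have "\<dots> = ennreal \<bar>det (matrix L)\<bar> * (\<integral>\<^sup>+x. f (L x) \<partial>lborel)"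
    by (simp add: nn_integral_density nn_integral_distr nn_integral_cmult)
  finally have "ennreal (1 / \<bar>det (matrix L)\<bar>) * (\<integral>\<^sup>+x. f x \<partial>lborel)
      = (ennreal (1 / \<bar>det (matrix L)\<bar>) * ennreal \<bar>det (matrix L)\<bar>) * (\<integral>\<^sup>+x. f (L x) \<partial>lborel)"
    by (simp add: mult.assoc)
  then show ?thesis using det by (simp add: ennreal_mult[symmetric])
qed

lemma det_rank_one_update_axis:
  fixes k :: "'n :: finite"
  shows "det (matrix (\<lambda>q :: real^'n. q - (c * (q \<bullet> axis k 1)) *\<^sub>R axis k 1)) = 1 - c"
proof -
  let ?A = "matrix (\<lambda>q :: real^'n. q - (c * (q \<bullet> axis k 1)) *\<^sub>R axis k 1)"
  have entry: "?A $ i $ j = (if i = j then if i = k then 1 - c else 1 else 0)" for i j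
    by (simp add: matrix_def inner_axis_axis) (simp add: axis_def)
  then have "det ?A = (\<Prod>i\<in>UNIV. ?A $ i $ i)" by (intro det_diagonal) simp
  also have "\<dots> = 1 - c" by (simp add: entry)
  finally show ?thesis .
qed

lemma linear_rank_one_update:
  fixes n :: "'a :: real_inner"
  shows "linear (\<lambda>q. q - (c * (q \<bullet> n)) *\<^sub>R n)"
  by (rule linearI) (simp_all add: algebra_simps)

text \<open>An orthogonal transformation carrying a coordinate axis to \<open>n\<close> reduces to the diagonal case.\<close>

lemma det_rank_one_update:
  fixes n :: "real^'n"
  assumes unit: "norm n = 1"
  shows "det (matrix (\<lambda>q. q - (c * (q \<bullet> n)) *\<^sub>R n)) = 1 - c"
proof -
  define k :: 'n where "k = undefined"
  let ?P = "\<lambda>n q :: real^'n. q - (c * (q \<bullet> n)) *\<^sub>R n"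
  obtain f :: "real^'n \<Rightarrow> real^'n" where f: "orthogonal_transformation f" "f (axis k 1) = n"
    using orthogonal_transformation_exists_1[of "axis k 1" n] unit by auto
  then have lin: "linear f" by (simp add: orthogonal_transformation_linear)
  have "f q \<bullet> n = q \<bullet> axis k 1" for q
    using f(1) unfolding f(2)[symmetric] by (simp add: orthogonal_transformation_def)
  then have "?P n \<circ> f = f \<circ> ?P (axis k 1)"
    using f(2) by (auto simp: linear_diff[OF lin] linear_scale[OF lin])
  then have "matrix (?P n) ** matrix f = matrix f ** matrix (?P (axis k 1))"
    using matrix_compose[OF lin linear_rank_one_update[of c n]]
      matrix_compose[OF linear_rank_one_update[of c "axis k 1"] lin] by simp
  then have "det (matrix (?P n)) * det (matrix f) = det (matrix f) * det (matrix (?P (axis k 1)))"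
    by (simp only: det_mul[symmetric])
  moreover have "\<bar>det (matrix f)\<bar> = 1" using f(1) by simp
  then have "det (matrix f) \<noteq> 0" by auto
  ultimately show ?thesis by (simp add: det_rank_one_update_axis)
qed

lemma nn_integral_rank_one_update:
  fixes n :: "real^'n::{finite,wellorder}" and f :: "real^'n::_ \<Rightarrow> ennreal"
  assumes "norm n = 1" "c \<noteq> 1" "f \<in> borel_measurable borel"
  shows "(\<integral>\<^sup>+q. f (q - (c * (q \<bullet> n)) *\<^sub>R n) \<partial>lborel) = ennreal (1 / \<bar>1 - c\<bar>) * (\<integral>\<^sup>+q. f q \<partial>lborel)"
  using nn_integral_lborel_linear[OF linear_rank_one_update[of c n] _ assms(3)] assms
  by (simp add: det_rank_one_update)

lemma borel_measurable_fst[measurable (raw)]: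
  fixes f :: "'a \<Rightarrow> 'b :: second_countable_topology \<times> 'c :: second_countable_topology"
  assumes "f \<in> borel_measurable N"
  shows "(\<lambda>x. fst (f x)) \<in> borel_measurable N"
  using assms by (rule borel_measurable_continuous_on[rotated]) (intro continuous_intros)

lemma borel_measurable_snd[measurable (raw)]:
  fixes f :: "'a \<Rightarrow> 'b :: second_countable_topology \<times> 'c :: second_countable_topology"
  assumes "f \<in> borel_measurable N"
  shows "(\<lambda>x. snd (f x)) \<in> borel_measurable N"
  using assms by (rule borel_measurable_continuous_on[rotated]) (intro continuous_intros)

lemma nn_integral_lborel_fst_snd:
  fixes f :: "'a::euclidean_space \<times> 'b::euclidean_space \<Rightarrow> ennreal"
  assumes "f \<in> borel_measurable borel"
  shows "(\<integral>\<^sup>+z. f z \<partial>lborel) = (\<integral>\<^sup>+x. \<integral>\<^sup>+v. f (x, v) \<partial>lborel \<partial>lborel)"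
    and "(\<integral>\<^sup>+z. f z \<partial>lborel) = (\<integral>\<^sup>+v. \<integral>\<^sup>+x. f (x, v) \<partial>lborel \<partial>lborel)"
proof -
  have f: "f \<in> borel_measurable (lborel \<Otimes>\<^sub>M lborel)" using assms by (simp add: lborel_prod)
  show "(\<integral>\<^sup>+z. f z \<partial>lborel) = (\<integral>\<^sup>+x. \<integral>\<^sup>+v. f (x, v) \<partial>lborel \<partial>lborel)"
    unfolding lborel_prod[symmetric] by (rule lborel.nn_integral_fst[symmetric, OF f])
  show "(\<integral>\<^sup>+z. f z \<partial>lborel) = (\<integral>\<^sup>+v. \<integral>\<^sup>+x. f (x, v) \<partial>lborel \<partial>lborel)"
    unfolding lborel_prod[symmetric] by (rule lborel_pair.nn_integral_snd[symmetric, OF f])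
qed

definition free_flow :: "real \<Rightarrow> 'a::real_vector \<times> 'a \<Rightarrow> 'a \<times> 'a" where
  "free_flow t z = (fst z + t *\<^sub>R snd z, snd z)"

lemma snd_free_flow [simp]: "snd (free_flow t z) = snd z"
  and free_flow_0 [simp]: "free_flow 0 z = z"
  and free_flow_add [simp]: "free_flow s (free_flow t z) = free_flow (t + s) z"
  by (simp_all add: free_flow_def scaleR_add_left)

lemma continuous_on_free_flow [continuous_intros]:
  fixes g :: "'b::topological_space \<Rightarrow> 'a::real_normed_vector \<times> 'a"
  assumes "continuous_on S s" "continuous_on S g"
  shows "continuous_on S (\<lambda>x. free_flow (s x) (g x))"
  unfolding free_flow_def using assms by (intro continuous_intros)

lemma borel_measurable_free_flow [measurable (raw)]:
  fixes g :: "'b \<Rightarrow> 'a::euclidean_space \<times> 'a"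
  assumes [measurable]: "s \<in> borel_measurable N" "g \<in> borel_measurable N"
  shows "(\<lambda>x. free_flow (s x) (g x)) \<in> borel_measurable N"
  unfolding free_flow_def by measurable

lemma nn_integral_free_flow:
  fixes g :: "'a::euclidean_space \<times> 'a \<Rightarrow> ennreal"
  assumes [measurable]: "g \<in> borel_measurable borel"
  shows "(\<integral>\<^sup>+z. g (free_flow t z) \<partial>lborel) = (\<integral>\<^sup>+z. g z \<partial>lborel)"
proof -
  have "(\<integral>\<^sup>+z. g (free_flow t z) \<partial>lborel) = (\<integral>\<^sup>+v. \<integral>\<^sup>+x. g (x + t *\<^sub>R v, v) \<partial>lborel \<partial>lborel)"
    by (subst nn_integral_lborel_fst_snd(2)) (measurable, simp add: free_flow_def)
  also have "\<dots> = (\<integral>\<^sup>+v. \<integral>\<^sup>+x. g (x, v) \<partial>lborel \<partial>lborel)"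
    by (intro nn_integral_cong nn_integral_lborel_translate) measurable
  also have "\<dots> = (\<integral>\<^sup>+z. g z \<partial>lborel)"
    by (rule nn_integral_lborel_fst_snd(2)[symmetric]) measurable
  finally show ?thesis .
qed

lemma distr_free_flow:
  "distr lborel borel (free_flow t) = (lborel :: ('a::euclidean_space \<times> 'a) measure)"
proof (rule measure_eqI)
  fix A assume "A \<in> sets (distr lborel borel (free_flow t :: 'a \<times> 'a \<Rightarrow> _))"
  then have A[measurable]: "A \<in> sets borel" by simp
  have "emeasure (distr lborel borel (free_flow t)) A = (\<integral>\<^sup>+z. indicator A (free_flow t z) \<partial>lborel)"
    by (subst nn_integral_indicator[symmetric], simp, subst nn_integral_distr) auto
  also have "\<dots> = emeasure lborel A"
    by (subst nn_integral_free_flow) auto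
  finally show "emeasure (distr lborel borel (free_flow t)) A = emeasure lborel A" .
qed simp

lemma integral_free_flow:
  fixes g :: "'a::euclidean_space \<times> 'a \<Rightarrow> real"
  assumes [measurable]: "g \<in> borel_measurable borel"
  shows "(\<integral>z. g (free_flow t z) \<partial>lborel) = (\<integral>z. g z \<partial>lborel)"
  using integral_distr[of "free_flow t" lborel borel g] by (simp add: distr_free_flow)

section \<open>Gaussian moments\<close>

lemma nn_integral_gaussian_finite:
  fixes b :: real
  assumes "0 < b"
  shows "(\<integral>\<^sup>+x. ennreal (exp (- b * x\<^sup>2)) \<partial>lborel) < \<infinity>"
proof -
  have "exp (- b * x\<^sup>2) = sqrt (pi / b) * normal_density 0 (1 / sqrt (2 * b)) x" for x
    using assms
    by (simp add: normal_density_def power_divide power_mult_distrib real_sqrt_mult real_sqrt_divide)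
  then have "integrable lborel (\<lambda>x. exp (- b * x\<^sup>2))"
    using assms integrable_normal_density[of "1 / sqrt (2 * b)" 0] by simp
  then show ?thesis by (simp add: nn_integral_eq_integral)
qed

lemma polynomial_times_gaussian_le:
  fixes b r :: real
  assumes b: "0 < b" and r: "0 \<le> r"
  shows "(1 + r) ^ k * exp (- b * r\<^sup>2) \<le> exp ((real k)\<^sup>2 / (2 * b)) * exp (- (b / 2) * r\<^sup>2)"
proof -
  have "(1 + r) ^ k \<le> exp (real k * r)"
    unfolding exp_of_nat_mult using r by (intro power_mono) auto
  moreover have "0 \<le> (real k / sqrt (2 * b) - sqrt (b / 2) * r)\<^sup>2" by simp
  then have "real k * r \<le> (real k)\<^sup>2 / (2 * b) + (b / 2) * r\<^sup>2"
    using b by (simp add: power2_diff power_divide power_mult_distrib real_sqrt_divide real_sqrt_mult)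
  ultimately have "(1 + r) ^ k \<le> exp ((real k)\<^sup>2 / (2 * b) + (b / 2) * r\<^sup>2)"
    by (meson exp_le_cancel_iff order_trans)
  then have "(1 + r) ^ k * exp (- b * r\<^sup>2)
      \<le> exp ((real k)\<^sup>2 / (2 * b) + (b / 2) * r\<^sup>2) * exp (- b * r\<^sup>2)"
    by (rule mult_right_mono) simp
  also have "\<dots> = exp ((real k)\<^sup>2 / (2 * b)) * exp (- (b / 2) * r\<^sup>2)"
    by (simp add: exp_add[symmetric])
  finally show ?thesis .
qed

lemma gaussian_eq_prod:
  fixes w :: "'a :: euclidean_space"
  shows "exp (- b * (norm w)\<^sup>2) = (\<Prod>i\<in>Basis. exp (- b * (w \<bullet> i)\<^sup>2))"
proof -
  have "(norm w)\<^sup>2 = (\<Sum>i\<in>Basis. (w \<bullet> i)\<^sup>2)"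
    unfolding power2_norm_eq_inner euclidean_inner[of w w] by (simp add: power2_eq_square)
  then show ?thesis by (simp add: exp_sum[symmetric] sum_distrib_left sum_negf)
qed

lemma nn_integral_gaussian_moment_finite:
  fixes u :: "'a :: euclidean_space"
  assumes b: "0 < b"
  shows "(\<integral>\<^sup>+w. ennreal ((1 + norm w) ^ k * exp (- b * (norm (w - u))\<^sup>2)) \<partial>lborel) < \<infinity>"
proof -
  define C where "C = (1 + norm u) ^ k * exp ((real k)\<^sup>2 / (2 * b))"
  have bound: "(1 + norm (w + u)) ^ k * exp (- b * (norm w)\<^sup>2)
      \<le> C * (\<Prod>i\<in>Basis. exp (- (b / 2) * (w \<bullet> i)\<^sup>2))"
    for w :: 'a
  proof -
    have "1 + norm (w + u) \<le> 1 + (norm w + norm u)" by (intro add_left_mono norm_triangle_ineq)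
    also have "\<dots> \<le> (1 + norm u) * (1 + norm w)" by (simp add: algebra_simps)
    finally have "(1 + norm (w + u)) ^ k \<le> (1 + norm u) ^ k * (1 + norm w) ^ k"
      unfolding power_mult_distrib[symmetric] by (intro power_mono) auto
    then have "(1 + norm (w + u)) ^ k * exp (- b * (norm w)\<^sup>2)
        \<le> (1 + norm u) ^ k * ((1 + norm w) ^ k * exp (- b * (norm w)\<^sup>2))"
      unfolding mult.assoc[symmetric] by (rule mult_right_mono) simp
    also have "\<dots> \<le> (1 + norm u) ^ k * (exp ((real k)\<^sup>2 / (2 * b)) * exp (- (b / 2) * (norm w)\<^sup>2))"
      using b by (intro mult_left_mono polynomial_times_gaussian_le) auto
    finally show ?thesis by (simp only: C_def mult.assoc gaussian_eq_prod[symmetric])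
  qed
  have "(\<integral>\<^sup>+w. ennreal ((1 + norm w) ^ k * exp (- b * (norm (w - u))\<^sup>2)) \<partial>lborel)
      = (\<integral>\<^sup>+w. ennreal ((1 + norm (w + u)) ^ k * exp (- b * (norm w)\<^sup>2)) \<partial>lborel)"
    using nn_integral_lborel_translate[of
        "\<lambda>w. ennreal ((1 + norm w) ^ k * exp (- b * (norm (w - u))\<^sup>2))" u]
    by simp
  also have "\<dots> \<le> (\<integral>\<^sup>+(w :: 'a). ennreal C * (\<Prod>i\<in>Basis. ennreal (exp (- (b / 2) * (w \<bullet> i)\<^sup>2))) \<partial>lborel)"
    using bound
    by (intro nn_integral_mono) (simp add: prod_ennreal ennreal_mult[symmetric] prod_nonneg C_def)
  also have "\<dots> = ennreal C * (\<Prod>i\<in>(Basis :: 'a set). (\<integral>\<^sup>+x. ennreal (exp (- (b / 2) * x\<^sup>2)) \<partial>lborel))"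
    by (subst nn_integral_cmult, measurable) (subst nn_integral_lborel_prod, auto)
  also have "\<dots> < \<infinity>"
    using nn_integral_gaussian_finite[of "b / 2"] b
    by (auto simp: ennreal_mult_less_top ennreal_prod_eq_top power_less_top_ennreal)
  finally show ?thesis .
qed

lemma Maxw_nonneg: "0 \<le> Maxw m1 u1 th1 w"
  by (simp add: Maxw_def)

lemma borel_measurable_Maxw[measurable]: "Maxw m1 u1 th1 \<in> borel_measurable borel"
  unfolding Maxw_def by measurable

lemma nn_integral_Maxw_moment_finite:
  assumes "0 < m1" "0 < th1"
  shows "(\<integral>\<^sup>+w. ennreal ((1 + norm w) ^ k * Maxw m1 u1 th1 w) \<partial>lborel) < \<infinity>"
proof -
  let ?c = "(m1 / (2 * pi * th1)) powr (3/2)" and ?b = "m1 / (2 * th1)"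
  have "ennreal ((1 + norm w) ^ k * Maxw m1 u1 th1 w)
      = ennreal ?c * ennreal ((1 + norm w) ^ k * exp (- ?b * (norm (w - u1))\<^sup>2))" for w
    by (simp add: Maxw_def ennreal_mult[symmetric] mult_ac)
  then have "(\<integral>\<^sup>+w. ennreal ((1 + norm w) ^ k * Maxw m1 u1 th1 w) \<partial>lborel)
      = ennreal ?c * (\<integral>\<^sup>+w. ennreal ((1 + norm w) ^ k * exp (- ?b * (norm (w - u1))\<^sup>2)) \<partial>lborel)"
    by (simp add: nn_integral_cmult)
  also have "\<dots> < \<infinity>"
    using nn_integral_gaussian_moment_finite[of ?b k u1] assms by (simp add: ennreal_mult_less_top)
  finally show ?thesis .
qed

section \<open>The surface measure of the sphere\<close>

lemma sets_sphere_meas[simp, measurable_cong]: "sets sphere_meas = sets borel"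
  by (simp add: sphere_meas_def)

lemma space_sphere_meas[simp]: "space sphere_meas = UNIV"
  by (simp add: sphere_meas_def)

lemma borel_measurable_cone_density:
  "(\<lambda>y :: vec3. ennreal 3 * indicator (ball 0 1) y) \<in> borel_measurable lborel"
  by (intro borel_measurable_times_ennreal borel_measurable_const borel_measurable_indicator) simp

lemma finite_measure_sphere_meas: "finite_measure sphere_meas"
proof
  have "emeasure sphere_meas UNIV = 3 * emeasure lborel (ball (0 :: vec3) 1)"
    unfolding sphere_meas_def
    using borel_measurable_cone_density
    by (subst emeasure_distr) (auto simp: emeasure_density nn_integral_cmult_indicator)
  moreover have "emeasure lborel (ball (0 :: vec3) 1) < \<infinity>"
    using emeasure_bounded_finite[of "ball (0 :: vec3) 1"] by simp
  ultimately show "emeasure sphere_meas (space sphere_meas) \<noteq> \<infinity>"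
    by (simp add: ennreal_mult_eq_top_iff less_top)
qed

interpretation sphere_meas: finite_measure sphere_meas
  by (rule finite_measure_sphere_meas)

interpretation lborel_sphere: pair_sigma_finite "lborel :: vec3 measure" sphere_meas ..

lemma AE_sphere_meas_norm: "AE n in sphere_meas. norm n = 1"
proof -
  have "AE y in lborel. (y :: vec3) \<noteq> 0" by (rule AE_lborel_singleton)
  then have "AE y in density lborel (\<lambda>y :: vec3. ennreal 3 * indicator (ball 0 1) y).
      norm (y /\<^sub>R norm y) = 1"
    by (subst AE_density[OF borel_measurable_cone_density]) (auto elim!: eventually_mono)
  then show ?thesis unfolding sphere_meas_def
    by (subst AE_distr_iff) auto
qed

lemma AE_lborel_sphere_norm: "AE p in (lborel :: vec3 measure) \<Otimes>\<^sub>M sphere_meas. norm (snd p) = 1"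
proof (rule lborel_sphere.AE_pair_measure)
  have "Measurable.pred ((lborel :: vec3 measure) \<Otimes>\<^sub>M sphere_meas) (\<lambda>p. norm (snd p) = 1)" by measurable
  then show "{p \<in> space ((lborel :: vec3 measure) \<Otimes>\<^sub>M sphere_meas). norm (snd p) = 1}
      \<in> sets ((lborel :: vec3 measure) \<Otimes>\<^sub>M sphere_meas)"
    by (simp only: pred_def)
qed (use AE_sphere_meas_norm in simp)

lemma nn_integral_lborel_sphere_swap:
  fixes F :: "vec3 \<Rightarrow> vec3 \<times> vec3 \<Rightarrow> ennreal"
  assumes [measurable]: "(\<lambda>(v, p). F v p) \<in> borel_measurable (borel \<Otimes>\<^sub>M (borel \<Otimes>\<^sub>M borel))"
  shows "(\<integral>\<^sup>+v. \<integral>\<^sup>+p. F v p \<partial>(lborel \<Otimes>\<^sub>M sphere_meas) \<partial>lborel)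
       = (\<integral>\<^sup>+n. \<integral>\<^sup>+v. \<integral>\<^sup>+w. F v (w, n) \<partial>lborel \<partial>lborel \<partial>sphere_meas)"
proof -
  have "(\<integral>\<^sup>+v. \<integral>\<^sup>+p. F v p \<partial>(lborel \<Otimes>\<^sub>M sphere_meas) \<partial>lborel)
      = (\<integral>\<^sup>+v. \<integral>\<^sup>+n. \<integral>\<^sup>+w. F v (w, n) \<partial>lborel \<partial>sphere_meas \<partial>lborel)"
    by (intro nn_integral_cong lborel_sphere.nn_integral_snd[symmetric]) measurable
  also have "\<dots> = (\<integral>\<^sup>+n. \<integral>\<^sup>+v. \<integral>\<^sup>+w. F v (w, n) \<partial>lborel \<partial>lborel \<partial>sphere_meas)"
    by (rule lborel_sphere.Fubini'[symmetric]) measurable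
  finally show ?thesis .
qed

section \<open>The resolvent of free transport with absorption\<close>

lemma exponential_decay_tendsto_0:
  fixes a :: real
  assumes "0 < a"
  shows "((\<lambda>t. exp (- a * t)) \<longlongrightarrow> 0) at_top"
proof -
  have "filterlim (\<lambda>t. a * t) at_top at_top"
    using assms by (rule filterlim_tendsto_pos_mult_at_top[OF tendsto_const _ filterlim_ident])
  then have "filterlim (\<lambda>t. - a * t) at_bot at_top"
    by (simp add: filterlim_uminus_at_bot)
  then show ?thesis by (rule filterlim_compose[OF exp_at_bot])
qed

lemma nn_integral_exponential:
  assumes "0 < (a :: real)"
  shows "(\<integral>\<^sup>+t. ennreal (a * (indicator {0..} t * exp (- a * t))) \<partial>lborel) = 1"
proof -
  interpret prob_space "density lborel (exponential_density a)"
    using assms by (rule prob_space_exponential_density)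
  have "(\<integral>\<^sup>+t. ennreal (a * (indicator {0..} t * exp (- a * t))) \<partial>lborel)
      = (\<integral>\<^sup>+t. ennreal (exponential_density a t) * indicator UNIV t \<partial>lborel)"
    by (intro nn_integral_cong) (simp add: exponential_density_def indicator_def mult.commute)
  also have "\<dots> = 1" using emeasure_space_1 by (simp add: emeasure_density)
  finally show ?thesis .
qed

lemma integral_FTC_atLeast:
  fixes f F :: "real \<Rightarrow> real"
  assumes deriv: "\<And>t. a \<le> t \<Longrightarrow> (F has_real_derivative f t) (at t)"
    and cont: "continuous_on {a..} f"
    and int: "integrable lborel (\<lambda>t. indicator {a..} t * f t)" and lim: "(F \<longlongrightarrow> L) at_top"
  shows "(\<integral>t. indicator {a..} t * f t \<partial>lborel) = L - F a"
proof (rule tendsto_unique)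
  show "((\<lambda>y. \<integral>t. indicator {..y} t *\<^sub>R (indicator {a..} t * f t) \<partial>lborel)
      \<longlongrightarrow> (\<integral>t. indicator {a..} t * f t \<partial>lborel)) at_top"
    using int by (rule tendsto_integral_at_top[rotated]) simp
  have truncated: "F y - F a = (\<integral>t. indicator {..y} t *\<^sub>R (indicator {a..} t * f t) \<partial>lborel)"
    if "a \<le> y" for y
  proof -
    have "(\<integral>t. indicator {..y} t *\<^sub>R (indicator {a..} t * f t) \<partial>lborel)
        = (\<integral>t. indicator {a..y} t *\<^sub>R f t \<partial>lborel)"
      by (intro Bochner_Integration.integral_cong) (auto simp: indicator_def)
    also have "\<dots> = F y - F a"
      using deriv cont that
      by (intro integral_FTC_atLeastAtMost)
        (auto simp: has_real_derivative_iff_has_vector_derivative[symmetric]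
          intro: has_field_derivative_at_within continuous_on_subset)
    finally show ?thesis by (rule sym)
  qed
  have "\<forall>\<^sub>F y in at_top. F y - F a = (\<integral>t. indicator {..y} t *\<^sub>R (indicator {a..} t * f t) \<partial>lborel)"
    using eventually_ge_at_top[of a] by eventually_elim (rule truncated)
  moreover have "((\<lambda>y. F y - F a) \<longlongrightarrow> L - F a) at_top" by (intro tendsto_intros lim)
  ultimately show "((\<lambda>y. \<integral>t. indicator {..y} t *\<^sub>R (indicator {a..} t * f t) \<partial>lborel) \<longlongrightarrow> L - F a) at_top"
    by (rule Lim_transform_eventually[rotated])
qed simp

lemma integrable_exponential_times_bounded:
  fixes f :: "real \<Rightarrow> real"
  assumes a: "0 < a" and f: "f \<in> borel_measurable borel" and bounded: "\<And>t. \<bar>f t\<bar> \<le> C"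
  shows "integrable lborel (\<lambda>t. indicator {0..} t * (exp (- a * t) * f t))"
proof (rule Bochner_Integration.integrable_bound)
  let ?density = "\<lambda>t. a * (indicator {0..} t * exp (- a * t))"
  show "integrable lborel (\<lambda>t. C / a * ?density t)"
    using nn_integral_exponential[OF a] a
    by (intro integrable_mult_right integrableI_nonneg) (auto simp: indicator_def)
  show "(\<lambda>t. indicator {0..} t * (exp (- a * t) * f t)) \<in> borel_measurable lborel"
    using f by simp
  have "norm (indicator {0..} t * (exp (- a * t) * f t)) \<le> norm (C / a * ?density t)" for t
    using a order_trans[OF bounded abs_ge_self] by (simp add: abs_mult indicator_def)
  then show "AE t in lborel. norm (indicator {0..} t * (exp (- a * t) * f t))
      \<le> norm (C / a * ?density t)"
    by simp
qed

lemma integral_exponential_FTC: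
  fixes g g' :: "real \<Rightarrow> real"
  assumes a: "0 < a" and deriv: "\<And>t. (g has_real_derivative g' t) (at t)"
    and cont': "continuous_on UNIV g'"
    and bounded: "\<And>t. \<bar>g t\<bar> \<le> C" and bounded': "\<And>t. \<bar>g' t\<bar> \<le> C'"
  shows "(\<integral>t. indicator {0..} t * exp (- a * t) * (a * g t - g' t) \<partial>lborel) = g 0"
proof -
  let ?f = "\<lambda>t. exp (- a * t) * (a * g t - g' t)" and ?F = "\<lambda>t. - exp (- a * t) * g t"
  have cont: "continuous_on UNIV g"
    using deriv by (meson DERIV_isCont continuous_at_imp_continuous_on)
  have "(\<integral>t. indicator {0..} t * ?f t \<partial>lborel) = 0 - ?F 0"
  proof (rule integral_FTC_atLeast)
    show "(?F has_real_derivative ?f t) (at t)" for t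
      by (auto intro!: derivative_eq_intros deriv simp: algebra_simps)
    show "continuous_on {0..} ?f"
      by (intro continuous_intros continuous_on_subset[OF cont] continuous_on_subset[OF cont']) auto
    show "integrable lborel (\<lambda>t. indicator {0..} t * ?f t)"
    proof (rule integrable_exponential_times_bounded[OF a])
      show "(\<lambda>t. a * g t - g' t) \<in> borel_measurable borel"
        by (intro borel_measurable_continuous_onI continuous_intros cont cont')
      show "\<bar>a * g t - g' t\<bar> \<le> a * C + C'" for t
        using a bounded bounded'
        by (intro order_trans[OF abs_triangle_ineq4] add_mono) (simp_all add: abs_mult)
    qed
    have "((\<lambda>t. C * exp (- a * t)) \<longlongrightarrow> 0) at_top"
      by (rule tendsto_mult_right_zero[OF exponential_decay_tendsto_0[OF a]])
    then show "(?F \<longlongrightarrow> 0) at_top"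
      by (rule Lim_null_comparison[rotated])
        (auto intro!: always_eventually mult_right_mono bounded
          simp: abs_mult mult.commute[of _ "\<bar>g _\<bar>"])
  qed
  then show ?thesis by (simp add: mult.assoc)
qed

lemma integrable_pair_lborelI:
  fixes U :: "'a::euclidean_space \<Rightarrow> 'b::euclidean_space \<Rightarrow> real"
  assumes [measurable]: "(\<lambda>(x, y). U x y) \<in> borel_measurable (lborel \<Otimes>\<^sub>M lborel)"
    and fin: "(\<integral>\<^sup>+x. \<integral>\<^sup>+y. ennreal \<bar>U x y\<bar> \<partial>lborel \<partial>lborel) < \<infinity>"
  shows "integrable (lborel \<Otimes>\<^sub>M lborel) (\<lambda>(x, y). U x y)"
proof (rule integrableI_bounded)
  have "(\<integral>\<^sup>+p. ennreal (norm (case p of (x, y) \<Rightarrow> U x y)) \<partial>(lborel \<Otimes>\<^sub>M lborel))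
     = (\<integral>\<^sup>+x. \<integral>\<^sup>+y. ennreal \<bar>U x y\<bar> \<partial>lborel \<partial>lborel)"
    by (subst lborel.nn_integral_fst[symmetric]) auto
  with fin show "(\<integral>\<^sup>+p. ennreal (norm (case p of (x, y) \<Rightarrow> U x y)) \<partial>(lborel \<Otimes>\<^sub>M lborel)) < \<infinity>" by simp
qed measurable

definition survival :: "('a \<Rightarrow> real) \<Rightarrow> 'a \<Rightarrow> real \<Rightarrow> real" where
  "survival a v t = indicator {0..} t * exp (- a v * t)"

definition transport_resolvent ::
    "('a::euclidean_space \<Rightarrow> real) \<Rightarrow> ('a \<times> 'a \<Rightarrow> real) \<Rightarrow> 'a \<times> 'a \<Rightarrow> real" where
  "transport_resolvent a f z = (\<integral>t. survival a (snd z) t * f (free_flow (- t) z) \<partial>lborel)"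

lemma survival_nonneg: "0 \<le> survival a v t"
  by (simp add: survival_def)

lemma transport_resolvent_nonneg: "(\<And>z. 0 \<le> f z) \<Longrightarrow> 0 \<le> transport_resolvent a f z"
  unfolding transport_resolvent_def by (intro integral_nonneg_AE) (simp add: survival_nonneg)

lemma transport_resolvent_velocity_weight:
  "transport_resolvent a (\<lambda>z. g (snd z) * f z) z = g (snd z) * transport_resolvent a f z"
  unfolding transport_resolvent_def by (simp add: mult.left_commute flip: integral_mult_right_zero)

locale absorbing_transport =
  fixes a :: "'a::euclidean_space \<Rightarrow> real" and c :: real
  assumes absorption_measurable [measurable]: "a \<in> borel_measurable borel"
    and lower_bound_pos: "0 < c" and lower_bound: "c \<le> a v"
begin

lemma absorption_pos: "0 < a v"
  using lower_bound_pos lower_bound[of v] by linarith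

lemma survival_measurable [measurable (raw)]:
  assumes [measurable]: "g \<in> borel_measurable N" "s \<in> borel_measurable N"
  shows "(\<lambda>x. survival a (g x) (s x)) \<in> borel_measurable N"
  unfolding survival_def by measurable

lemma nn_integral_absorption_survival: "(\<integral>\<^sup>+t. ennreal (a v * survival a v t) \<partial>lborel) = 1"
  using nn_integral_exponential[OF absorption_pos[of v]] by (simp add: survival_def)

lemma integral_survival: "(\<integral>t. survival a v t \<partial>lborel) = 1 / a v"
proof -
  have "(\<integral>t. a v * survival a v t \<partial>lborel) = 1"
    using nn_integral_absorption_survival[of v] absorption_pos[of v] survival_nonneg[of a v]
    by (subst integral_eq_nn_integral) auto
  then show ?thesis using absorption_pos[of v] by (simp add: field_simps)
qed

definition forward_kernel :: "('a \<times> 'a \<Rightarrow> real) \<Rightarrow> ('a \<times> 'a \<Rightarrow> real) \<Rightarrow> real \<Rightarrow> 'a \<times> 'a \<Rightarrow> real" where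
  "forward_kernel f \<eta> t z = survival a (snd z) t * f z * \<eta> (free_flow t z)"

definition backward_kernel :: "('a \<times> 'a \<Rightarrow> real) \<Rightarrow> ('a \<times> 'a \<Rightarrow> real) \<Rightarrow> real \<Rightarrow> 'a \<times> 'a \<Rightarrow> real" where
  "backward_kernel f \<eta> t z = survival a (snd z) t * f (free_flow (- t) z) * \<eta> z"

lemma kernels_measurable [measurable]:
  assumes [measurable]: "f \<in> borel_measurable borel" "\<eta> \<in> borel_measurable borel"
  shows "(\<lambda>(t, z). forward_kernel f \<eta> t z) \<in> borel_measurable (borel \<Otimes>\<^sub>M borel)"
    and "(\<lambda>(t, z). backward_kernel f \<eta> t z) \<in> borel_measurable (borel \<Otimes>\<^sub>M borel)"
  unfolding forward_kernel_def backward_kernel_def by measurable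

lemma backward_kernel_free_flow: "backward_kernel f \<eta> t (free_flow t z) = forward_kernel f \<eta> t z"
  by (simp add: backward_kernel_def forward_kernel_def)

lemma integrable_forward_kernel:
  assumes f: "integrable lborel f" and [measurable]: "\<eta> \<in> borel_measurable borel"
    and \<eta>: "\<And>z. \<bar>\<eta> z\<bar> \<le> C * a (snd z)"
  shows "integrable (lborel \<Otimes>\<^sub>M lborel) (\<lambda>(t, z). forward_kernel f \<eta> t z)"
proof (rule integrable_pair_lborelI)
  have [measurable]: "f \<in> borel_measurable borel" using f by simp
  show "(\<lambda>(t, z). forward_kernel f \<eta> t z) \<in> borel_measurable (lborel \<Otimes>\<^sub>M lborel)"
    by measurable
  have "(\<integral>\<^sup>+t. \<integral>\<^sup>+z. ennreal \<bar>forward_kernel f \<eta> t z\<bar> \<partial>lborel \<partial>lborel)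
     \<le> (\<integral>\<^sup>+t. \<integral>\<^sup>+z. ennreal \<bar>C * f z\<bar> * ennreal (a (snd z) * survival a (snd z) t) \<partial>lborel \<partial>lborel)"
  proof (intro nn_integral_mono)
    fix t :: real and z :: "'a \<times> 'a"
    have "\<bar>forward_kernel f \<eta> t z\<bar> \<le> survival a (snd z) t * \<bar>f z\<bar> * (\<bar>C\<bar> * a (snd z))"
      unfolding forward_kernel_def abs_mult abs_of_nonneg[OF survival_nonneg]
      using order_trans[OF \<eta>[of "free_flow t z"] mult_right_mono[OF abs_ge_self]]
        absorption_pos[of "snd z"]
      by (intro mult_left_mono) (auto simp: survival_nonneg)
    then show "ennreal \<bar>forward_kernel f \<eta> t z\<bar>
        \<le> ennreal \<bar>C * f z\<bar> * ennreal (a (snd z) * survival a (snd z) t)"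
      using absorption_pos[of "snd z"] survival_nonneg[of a "snd z" t]
      by (subst ennreal_mult[symmetric]) (auto intro!: ennreal_leI simp: abs_mult mult_ac)
  qed
  also have "\<dots>
      = (\<integral>\<^sup>+z. \<integral>\<^sup>+t. ennreal \<bar>C * f z\<bar> * ennreal (a (snd z) * survival a (snd z) t) \<partial>lborel \<partial>lborel)"
    by (rule lborel_pair.Fubini'[symmetric]) measurable
  also have "\<dots> = (\<integral>\<^sup>+z. ennreal \<bar>C * f z\<bar> \<partial>lborel)"
    by (simp add: nn_integral_cmult nn_integral_absorption_survival)
  also have "\<dots> < \<infinity>"
    using integrable_mult_right[OF f, of C] unfolding integrable_iff_bounded real_norm_def by blast
  finally show "(\<integral>\<^sup>+t. \<integral>\<^sup>+z. ennreal \<bar>forward_kernel f \<eta> t z\<bar> \<partial>lborel \<partial>lborel) < \<infinity>" .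
qed

lemma integrable_backward_kernel:
  assumes f: "integrable lborel f" and \<eta>_measurable [measurable]: "\<eta> \<in> borel_measurable borel"
    and \<eta>: "\<And>z. \<bar>\<eta> z\<bar> \<le> C * a (snd z)"
  shows "integrable (lborel \<Otimes>\<^sub>M lborel) (\<lambda>(t, z). backward_kernel f \<eta> t z)"
proof (rule integrable_pair_lborelI)
  have [measurable]: "f \<in> borel_measurable borel" using f by simp
  show "(\<lambda>(t, z). backward_kernel f \<eta> t z) \<in> borel_measurable (lborel \<Otimes>\<^sub>M lborel)"
    by measurable
  have "(\<integral>\<^sup>+z. ennreal \<bar>backward_kernel f \<eta> t z\<bar> \<partial>lborel)
      = (\<integral>\<^sup>+z. ennreal \<bar>forward_kernel f \<eta> t z\<bar> \<partial>lborel)" for t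
    using nn_integral_free_flow[of "\<lambda>z. ennreal \<bar>backward_kernel f \<eta> t z\<bar>" t]
    by (simp add: backward_kernel_free_flow)
  then have "(\<integral>\<^sup>+t. \<integral>\<^sup>+z. ennreal \<bar>backward_kernel f \<eta> t z\<bar> \<partial>lborel \<partial>lborel)
      = (\<integral>\<^sup>+p. ennreal (norm (case p of (t, z) \<Rightarrow> forward_kernel f \<eta> t z)) \<partial>(lborel \<Otimes>\<^sub>M lborel))"
    by (subst lborel.nn_integral_fst[symmetric]) simp_all
  also have "\<dots> < \<infinity>"
    using integrable_forward_kernel[OF f \<eta>_measurable \<eta>] unfolding integrable_iff_bounded by blast
  finally show "(\<integral>\<^sup>+t. \<integral>\<^sup>+z. ennreal \<bar>backward_kernel f \<eta> t z\<bar> \<partial>lborel \<partial>lborel) < \<infinity>" .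
qed

lemma transport_resolvent_duality:
  assumes f: "integrable lborel f" and \<eta>_measurable [measurable]: "\<eta> \<in> borel_measurable borel"
    and \<eta>: "\<And>z. \<bar>\<eta> z\<bar> \<le> C * a (snd z)"
  shows "integrable lborel (\<lambda>z. transport_resolvent a f z * \<eta> z)"
    and "(\<integral>z. transport_resolvent a f z * \<eta> z \<partial>lborel)
       = (\<integral>z. f z * (\<integral>t. survival a (snd z) t * \<eta> (free_flow t z) \<partial>lborel) \<partial>lborel)"
proof -
  have [measurable]: "f \<in> borel_measurable borel" using f by simp
  note backward = integrable_backward_kernel[OF f \<eta>_measurable \<eta>]
  have resolvent_times: "transport_resolvent a f z * \<eta> z = (\<integral>t. backward_kernel f \<eta> t z \<partial>lborel)" for z
    unfolding transport_resolvent_def backward_kernel_def by simp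
  show "integrable lborel (\<lambda>z. transport_resolvent a f z * \<eta> z)"
    unfolding resolvent_times by (rule lborel_pair.integrable_snd[OF backward])
  have "(\<integral>z. transport_resolvent a f z * \<eta> z \<partial>lborel)
      = (\<integral>t. \<integral>z. backward_kernel f \<eta> t z \<partial>lborel \<partial>lborel)"
    unfolding resolvent_times by (rule lborel_pair.Fubini_integral[OF backward])
  also have "\<dots> = (\<integral>t. \<integral>z. forward_kernel f \<eta> t z \<partial>lborel \<partial>lborel)"
  proof (rule Bochner_Integration.integral_cong[OF refl])
    show "(\<integral>z. backward_kernel f \<eta> t z \<partial>lborel) = (\<integral>z. forward_kernel f \<eta> t z \<partial>lborel)" for t
      using integral_free_flow[of "backward_kernel f \<eta> t" t] by (simp add: backward_kernel_free_flow)
  qed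
  also have "\<dots> = (\<integral>z. \<integral>t. forward_kernel f \<eta> t z \<partial>lborel \<partial>lborel)"
    by (rule lborel_pair.Fubini_integral[OF integrable_forward_kernel[OF f \<eta>_measurable \<eta>], symmetric])
  also have "\<dots> = (\<integral>z. f z * (\<integral>t. survival a (snd z) t * \<eta> (free_flow t z) \<partial>lborel) \<partial>lborel)"
    by (simp add: forward_kernel_def mult_ac flip: integral_mult_right_zero)
  finally show "(\<integral>z. transport_resolvent a f z * \<eta> z \<partial>lborel)
       = (\<integral>z. f z * (\<integral>t. survival a (snd z) t * \<eta> (free_flow t z) \<partial>lborel) \<partial>lborel)" .
qed

lemma integrable_transport_resolvent:
  assumes "integrable lborel f"
  shows "integrable lborel (transport_resolvent a f)"
  using transport_resolvent_duality(1)[OF assms, of "\<lambda>_. 1" "1 / c"] lower_bound lower_bound_pos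
  by (simp add: field_simps)

lemma absorption_transport_resolvent:
  assumes "integrable lborel f"
  shows "integrable lborel (\<lambda>z. a (snd z) * transport_resolvent a f z)"
    and "(\<integral>z. a (snd z) * transport_resolvent a f z \<partial>lborel) = (\<integral>z. f z \<partial>lborel)"
  using transport_resolvent_duality[OF assms, of "\<lambda>z. a (snd z)" 1] absorption_pos
  by (simp_all add: less_imp_le mult.commute integral_survival less_imp_neq[THEN not_sym])

lemma transport_resolvent_weak:
  assumes f: "integrable lborel f" and cont: "continuous_on UNIV \<phi>" "continuous_on UNIV D"
    and bounded: "\<And>z. \<bar>\<phi> z\<bar> \<le> C" "\<And>z. \<bar>D z\<bar> \<le> C'"
    and deriv: "\<And>z t. ((\<lambda>t. \<phi> (free_flow t z)) has_real_derivative D (free_flow t z)) (at t)"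
  shows "(\<integral>z. transport_resolvent a f z * (a (snd z) * \<phi> z - D z) \<partial>lborel) = (\<integral>z. f z * \<phi> z \<partial>lborel)"
proof -
  let ?\<eta> = "\<lambda>z. a (snd z) * \<phi> z - D z"
  have [measurable]: "\<phi> \<in> borel_measurable borel" "D \<in> borel_measurable borel"
    using cont by (auto intro: borel_measurable_continuous_onI)
  have \<eta>_le: "\<bar>?\<eta> z\<bar> \<le> (C + C' / c) * a (snd z)" for z
  proof -
    have "\<bar>D z\<bar> \<le> C' / c * c" using bounded(2)[of z] lower_bound_pos by simp
    also have "\<dots> \<le> C' / c * a (snd z)"
      using lower_bound lower_bound_pos order_trans[OF abs_ge_zero bounded(2)]
      by (intro mult_left_mono) auto
    finally have "\<bar>D z\<bar> \<le> C' / c * a (snd z)" .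
    moreover have "\<bar>a (snd z) * \<phi> z\<bar> \<le> a (snd z) * C"
      using bounded(1)[of z] absorption_pos[of "snd z"] by (simp add: abs_mult)
    ultimately show ?thesis by (simp add: algebra_simps)
  qed
  have "(\<integral>t. survival a (snd z) t * ?\<eta> (free_flow t z) \<partial>lborel) = \<phi> z" for z
  proof -
    have "continuous_on UNIV (\<lambda>t. D (free_flow t z))"
      by (rule continuous_on_compose2[OF cont(2)]) (auto intro!: continuous_intros)
    from integral_exponential_FTC[OF absorption_pos deriv this bounded(1) bounded(2), of "snd z"]
    show ?thesis by (simp add: survival_def)
  qed
  with transport_resolvent_duality(2)[OF f _ \<eta>_le] show ?thesis by simp
qed

end

abbreviation streaming :: "fn \<Rightarrow> fn" where
  "streaming \<phi> z \<equiv> frechet_derivative \<phi> (at z) (snd z, 0)"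

lemma test_fun_differentiable: "test_fun \<phi> \<Longrightarrow> \<phi> differentiable (at z)"
proof -
  assume "test_fun \<phi>"
  then have "Ck 1 \<phi>" unfolding test_fun_def by blast
  then show "\<phi> differentiable (at z)" by (cases z) simp
qed

lemma test_fun_continuous:
  assumes "test_fun \<phi>"
  shows "continuous_on UNIV \<phi>" and "continuous_on UNIV (streaming \<phi>)"
proof -
  have C1: "Ck 1 \<phi>" using assms unfolding test_fun_def by blast
  then show "continuous_on UNIV \<phi>" by simp
  have "streaming \<phi> = (\<lambda>z. \<Sum>i\<in>Basis. ((snd z, 0) \<bullet> i) * frechet_derivative \<phi> (at z) i)"
  proof
    fix z
    have lin: "linear (frechet_derivative \<phi> (at z))"
      using test_fun_differentiable[OF assms] by (rule linear_frechet_derivative)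
    have "streaming \<phi> z = frechet_derivative \<phi> (at z) (\<Sum>i\<in>Basis. ((snd z, 0) \<bullet> i) *\<^sub>R i)"
      by (simp only: euclidean_representation)
    also have "\<dots> = (\<Sum>i\<in>Basis. ((snd z, 0) \<bullet> i) * frechet_derivative \<phi> (at z) i)"
      by (simp add: linear_sum[OF lin] linear_cmul[OF lin])
    finally show "streaming \<phi> z = (\<Sum>i\<in>Basis. ((snd z, 0) \<bullet> i) * frechet_derivative \<phi> (at z) i)" .
  qed
  moreover have "continuous_on UNIV (\<lambda>z. frechet_derivative \<phi> (at z) i)" if "i \<in> Basis" for i
    using C1 that by simp
  ultimately show "continuous_on UNIV (streaming \<phi>)"
    by (simp only:) (intro continuous_intros)
qed

lemma bounded_of_compact_support:
  fixes h :: "'a::topological_space \<Rightarrow> real"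
  assumes h: "continuous_on UNIV h" and S: "compact S" and h0: "\<And>z. z \<notin> S \<Longrightarrow> h z = 0"
  shows "\<exists>C. \<forall>z. \<bar>h z\<bar> \<le> C"
proof -
  have "bounded (h ` S)"
    using h S by (intro compact_imp_bounded compact_continuous_image) (auto intro: continuous_on_subset)
  then obtain C where C: "\<And>z. z \<in> S \<Longrightarrow> \<bar>h z\<bar> \<le> C" by (auto simp: bounded_iff)
  have "\<bar>h z\<bar> \<le> max C 0" for z using C[of z] h0[of z] by (cases "z \<in> S") auto
  then show ?thesis by blast
qed

lemma test_fun_bounded:
  assumes "test_fun \<phi>"
  shows "\<exists>C. \<forall>z. \<bar>\<phi> z\<bar> \<le> C" and "\<exists>C. \<forall>z. \<bar>streaming \<phi> z\<bar> \<le> C"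
proof -
  let ?S = "closure {z. \<phi> z \<noteq> 0}"
  have S: "compact ?S" using assms unfolding test_fun_def by blast
  have \<phi>0: "\<phi> z = 0" if "z \<notin> ?S" for z
    using closure_subset[of "{z. \<phi> z \<noteq> 0}"] that by blast
  have "streaming \<phi> z = 0" if "z \<notin> ?S" for z
  proof -
    have "((\<lambda>_. 0) has_derivative (\<lambda>_. 0)) (at z)" by simp
    moreover have "open (- ?S)" by (intro open_Compl closed_closure)
    moreover have "z \<in> - ?S" using that by simp
    moreover have "0 = \<phi> y" if "y \<in> - ?S" for y using \<phi>0[of y] that by simp
    ultimately have "(\<phi> has_derivative (\<lambda>_. 0)) (at z)"
      by (rule has_derivative_transform_within_open)
    then show ?thesis by (simp add: frechet_derivative_at[symmetric])
  qed
  then show "\<exists>C. \<forall>z. \<bar>streaming \<phi> z\<bar> \<le> C"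
    by (intro bounded_of_compact_support[OF test_fun_continuous(2)[OF assms] S])
  show "\<exists>C. \<forall>z. \<bar>\<phi> z\<bar> \<le> C"
    using \<phi>0 by (intro bounded_of_compact_support[OF test_fun_continuous(1)[OF assms] S])
qed

lemma test_fun_measurable:
  assumes "test_fun \<phi>"
  shows "\<phi> \<in> borel_measurable borel" and "streaming \<phi> \<in> borel_measurable borel"
  using test_fun_continuous[OF assms] by (auto intro: borel_measurable_continuous_onI)

lemma test_fun_free_flow_derivative:
  assumes "test_fun \<phi>"
  shows "((\<lambda>t. \<phi> (free_flow t z)) has_real_derivative streaming \<phi> (free_flow t z)) (at t)"
proof -
  let ?D = "frechet_derivative \<phi> (at (free_flow t z))"
  have "((\<lambda>t. free_flow t z) has_derivative (\<lambda>h. (h *\<^sub>R snd z, 0))) (at t)"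
    unfolding free_flow_def by (auto intro!: derivative_eq_intros)
  moreover have diff: "\<phi> differentiable (at (free_flow t z))"
    using assms by (rule test_fun_differentiable)
  then have "(\<phi> has_derivative ?D) (at (free_flow t z))" by (rule frechet_derivative_works[THEN iffD1])
  ultimately have "((\<lambda>t. \<phi> (free_flow t z)) has_derivative (\<lambda>h. ?D (h *\<^sub>R snd z, 0))) (at t)"
    by (rule has_derivative_compose)
  moreover have "?D (h *\<^sub>R snd z, 0) = ?D (snd z, 0) * h" for h
    using linear_cmul[OF linear_frechet_derivative[OF diff], of h "(snd z, 0)"]
    by (simp add: scaleR_prod_def mult.commute)
  ultimately show ?thesis
    by (simp add: has_field_derivative_def)
qed

lemma L1_mult_test_fun:
  assumes "L1 f" "test_fun \<phi>"
  shows "L1 (\<lambda>z. f z * \<phi> z)" and "L1 (\<lambda>z. f z * streaming \<phi> z)"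
  using test_fun_measurable[OF assms(2)] test_fun_bounded[OF assms(2)] L1_mult_bounded[OF assms(1)]
  by blast+

lemma T0rel_transport_resolvent:
  fixes a :: "vec3 \<Rightarrow> real"
  assumes "absorbing_transport a c" and f: "L1 f"
  shows "T0rel (transport_resolvent a f) (\<lambda>z. a (snd z) * transport_resolvent a f z - f z)"
  unfolding T0rel_def
proof (intro conjI allI impI)
  interpret absorbing_transport a c by fact
  let ?R = "transport_resolvent a f"
  have R: "L1 ?R" "L1 (\<lambda>z. a (snd z) * ?R z)"
    using f integrable_transport_resolvent absorption_transport_resolvent(1) by (auto simp: L1_def)
  show "L1 ?R" by (rule R(1))
  show "L1 (\<lambda>z. a (snd z) * ?R z - f z)" using R(2) f by (rule L1_diff)
  fix \<phi> :: fn assume \<phi>: "test_fun \<phi>"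
  note products = L1_mult_test_fun[OF R(1) \<phi>] L1_mult_test_fun[OF R(2) \<phi>] L1_mult_test_fun[OF f \<phi>]
  obtain C C' where bounded: "\<And>z. \<bar>\<phi> z\<bar> \<le> C" "\<And>z. \<bar>streaming \<phi> z\<bar> \<le> C'"
    using test_fun_bounded[OF \<phi>] by blast
  have "(\<integral>z. (a (snd z) * ?R z - f z) * \<phi> z \<partial>lborel)
      = (\<integral>z. a (snd z) * ?R z * \<phi> z \<partial>lborel) - (\<integral>z. f z * \<phi> z \<partial>lborel)"
    using products(3,5) by (simp add: left_diff_distrib L1_def)
  also have "(\<integral>z. f z * \<phi> z \<partial>lborel) = (\<integral>z. ?R z * (a (snd z) * \<phi> z - streaming \<phi> z) \<partial>lborel)"
    using transport_resolvent_weak[OF f[unfolded L1_def] test_fun_continuous[OF \<phi>] bounded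
        test_fun_free_flow_derivative[OF \<phi>]] by simp
  also have "\<dots> = (\<integral>z. a (snd z) * ?R z * \<phi> z \<partial>lborel) - (\<integral>z. ?R z * streaming \<phi> z \<partial>lborel)"
    using products(2,3) by (simp add: algebra_simps L1_def)
  finally show "(\<integral>z. (a (snd z) * ?R z - f z) * \<phi> z \<partial>lborel) = (\<integral>z. ?R z * streaming \<phi> z \<partial>lborel)"
    by simp
qed

lemma T0rel_linear:
  assumes T: "T0rel f g" and T': "T0rel f' g'"
  shows "T0rel (\<lambda>z. f z + c * f' z) (\<lambda>z. g z + c * g' z)"
  unfolding T0rel_def
proof (intro conjI allI impI)
  have in_L1: "L1 f" "L1 g" "L1 f'" "L1 g'" using T T' unfolding T0rel_def by auto
  then show "L1 (\<lambda>z. f z + c * f' z)" "L1 (\<lambda>z. g z + c * g' z)" by (auto intro!: L1_intros)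
  fix \<phi> :: fn assume \<phi>: "test_fun \<phi>"
  have distrib: "(\<integral>z. (u z + c * u' z) * h z \<partial>lborel)
      = (\<integral>z. u z * h z \<partial>lborel) + c * (\<integral>z. u' z * h z \<partial>lborel)"
    if "L1 (\<lambda>z. u z * h z)" "L1 (\<lambda>z. u' z * h z)" for u u' h :: fn
    using that by (simp add: L1_def distrib_right mult.assoc)
  have "(\<integral>z. g z * \<phi> z \<partial>lborel) = (\<integral>z. f z * streaming \<phi> z \<partial>lborel)"
       "(\<integral>z. g' z * \<phi> z \<partial>lborel) = (\<integral>z. f' z * streaming \<phi> z \<partial>lborel)"
    using T T' \<phi> unfolding T0rel_def by auto
  then show "(\<integral>z. (g z + c * g' z) * \<phi> z \<partial>lborel) = (\<integral>z. (f z + c * f' z) * streaming \<phi> z \<partial>lborel)"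
    using distrib[OF L1_mult_test_fun(1)[OF in_L1(2) \<phi>] L1_mult_test_fun(1)[OF in_L1(4) \<phi>]]
      distrib[OF L1_mult_test_fun(2)[OF in_L1(1) \<phi>] L1_mult_test_fun(2)[OF in_L1(3) \<phi>]] by simp
qed

section \<open>The collision operator and its adjoint\<close>

lemma nn_integral_relative_coordinates:
  fixes H :: "'a::euclidean_space \<Rightarrow> 'a \<Rightarrow> ennreal"
  assumes [measurable]: "(\<lambda>(v, w). H v w) \<in> borel_measurable (borel \<Otimes>\<^sub>M borel)"
  shows "(\<integral>\<^sup>+v. \<integral>\<^sup>+w. H v w \<partial>lborel \<partial>lborel)
       = (\<integral>\<^sup>+q. \<integral>\<^sup>+w. H (q + (w + s q)) (w + s q) \<partial>lborel \<partial>lborel)"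
proof -
  have "(\<integral>\<^sup>+v. \<integral>\<^sup>+w. H v w \<partial>lborel \<partial>lborel) = (\<integral>\<^sup>+w. \<integral>\<^sup>+v. H v w \<partial>lborel \<partial>lborel)"
    by (rule lborel_pair.Fubini'[symmetric]) measurable
  also have "\<dots> = (\<integral>\<^sup>+w. \<integral>\<^sup>+q. H (q + w) w \<partial>lborel \<partial>lborel)"
    by (intro nn_integral_cong nn_integral_lborel_translate[symmetric]) measurable
  also have "\<dots> = (\<integral>\<^sup>+q. \<integral>\<^sup>+w. H (q + w) w \<partial>lborel \<partial>lborel)"
    by (rule lborel_pair.Fubini') measurable
  also have "\<dots> = (\<integral>\<^sup>+q. \<integral>\<^sup>+w. H (q + (w + s q)) (w + s q) \<partial>lborel \<partial>lborel)"
    by (intro nn_integral_cong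
          nn_integral_lborel_translate[symmetric, of "\<lambda>w. H (q + w) w" "s q" for q]) measurable
  finally show ?thesis .
qed

locale collision =
  fixes m m1 eps th1 :: real and u1 :: vec3
  assumes m_pos: "m > 0" and m1_pos: "m1 > 0" and eps_pos: "0 < eps" and eps_less_1: "eps < 1"
    and th1_pos: "th1 > 0"
begin

abbreviation M :: "vec3 \<Rightarrow> real" where "M \<equiv> Maxw m1 u1 th1"

abbreviation \<sigma> :: "vec3 \<Rightarrow> real" where "\<sigma> \<equiv> coll_freq m1 u1 th1"

abbreviation K :: "fn \<Rightarrow> fn" where "K \<equiv> Kop m m1 eps u1 th1"

abbreviation \<mu> :: "(vec3 \<times> vec3) measure" where "\<mu> \<equiv> lborel \<Otimes>\<^sub>M sphere_meas"

abbreviation impact :: "vec3 \<Rightarrow> vec3 \<times> vec3 \<Rightarrow> real" where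
  "impact v p \<equiv> \<bar>(v - fst p) \<bullet> snd p\<bar>"

abbreviation pre_velocity :: "vec3 \<Rightarrow> vec3 \<times> vec3 \<Rightarrow> vec3" where
  "pre_velocity v p \<equiv> vstar m m1 eps v (fst p) (snd p)"

abbreviation pre_partner :: "vec3 \<Rightarrow> vec3 \<times> vec3 \<Rightarrow> vec3" where
  "pre_partner v p \<equiv> wstar m m1 eps v (fst p) (snd p)"

definition \<kappa> :: real where "\<kappa> = alpha m m1 * (1 - beta eps)"

definition post_velocity :: "vec3 \<Rightarrow> vec3 \<times> vec3 \<Rightarrow> vec3" where
  "post_velocity v p = v - (2 * \<kappa> * ((v - fst p) \<bullet> snd p)) *\<^sub>R snd p"

definition K_nn :: "(phase \<Rightarrow> ennreal) \<Rightarrow> phase \<Rightarrow> ennreal" where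
  "K_nn f z = ennreal (eps powr (-2)) *
     (\<integral>\<^sup>+p. ennreal (impact (snd z) p * M (pre_partner (snd z) p))
        * f (fst z, pre_velocity (snd z) p) \<partial>\<mu>)"

definition K_adjoint :: "(vec3 \<Rightarrow> ennreal) \<Rightarrow> vec3 \<Rightarrow> ennreal" where
  "K_adjoint \<phi> v = (\<integral>\<^sup>+p. ennreal (impact v p * M (fst p)) * \<phi> (post_velocity v p) \<partial>\<mu>)"

lemma \<kappa>_bounds: "0 < \<kappa>" "\<kappa> < 1"
proof -
  have alpha_bounds: "0 < alpha m m1" "alpha m m1 < 1"
    using m_pos m1_pos by (auto simp: alpha_def field_simps)
  have beta_bounds: "0 < 1 - beta eps" "1 - beta eps < 1"
    using eps_pos eps_less_1 by (auto simp: beta_def field_simps)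
  show "0 < \<kappa>" unfolding \<kappa>_def using alpha_bounds beta_bounds by simp
  have "alpha m m1 * (1 - beta eps) < 1 * 1"
    using alpha_bounds beta_bounds by (intro mult_strict_mono) auto
  then show "\<kappa> < 1" by (simp add: \<kappa>_def)
qed

lemma one_minus_two_beta: "1 - 2 * beta eps = eps"
  by (simp add: beta_def field_simps)

lemma gam_eq: "gam m m1 eps = \<kappa> / eps"
  by (simp add: gam_def \<kappa>_def one_minus_two_beta)

lemma gam_plus_gambar: "2 * gam m m1 eps + 2 * gambar m m1 eps = (1 + eps) / eps"
proof -
  have "2 * gam m m1 eps + 2 * gambar m m1 eps = 2 * (1 - beta eps) / (1 - 2 * beta eps)"
    unfolding gam_def gambar_def by (simp add: algebra_simps flip: add_divide_distrib)
  moreover have "2 * (1 - beta eps) = 1 + eps" using one_minus_two_beta by simp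
  ultimately show ?thesis by (simp only: one_minus_two_beta)
qed

definition recoil :: "vec3 \<Rightarrow> vec3 \<Rightarrow> vec3" where
  "recoil n q = q - ((1 + eps) / eps * (q \<bullet> n)) *\<^sub>R n"

lemma recoil_measurable [measurable (raw)]:
  assumes [measurable]: "g \<in> borel_measurable N"
  shows "(\<lambda>x. recoil n (g x)) \<in> borel_measurable N"
  unfolding recoil_def by measurable

text \<open>In the coordinates \<open>(q, w)\<close> with \<open>q = v - w\<close> the collision is a translation of \<open>w\<close> along \<open>n\<close>
  followed by the linear map \<^term>\<open>recoil n\<close>, whose determinant is \<open>- 1 / \<epsilon>\<close>.\<close>

lemma collision_in_relative_coordinates:
  fixes q w n :: vec3
  assumes unit: "norm n = 1"
  defines "w' \<equiv> w + (- (2 * gambar m m1 eps) * (q \<bullet> n)) *\<^sub>R n"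
  shows "wstar m m1 eps (q + w') w' n = w"
    and "vstar m m1 eps (q + w') w' n = recoil n q + w"
    and "post_velocity (recoil n q + w) (w, n) = q + w'"
    and "\<bar>q \<bullet> n\<bar> = eps * \<bar>recoil n q \<bullet> n\<bar>"
proof -
  have "n \<bullet> n = 1" using unit by (simp add: dot_square_norm)
  then have normal: "recoil n q \<bullet> n = - (q \<bullet> n) / eps"
    using eps_pos by (simp add: recoil_def inner_diff_left field_simps)
  show "\<bar>q \<bullet> n\<bar> = eps * \<bar>recoil n q \<bullet> n\<bar>" unfolding normal using eps_pos by simp
  show "wstar m m1 eps (q + w') w' n = w"
    unfolding wstar_def w'_def by (simp add: algebra_simps)
  have recoil: "recoil n q = q - ((2 * gam m m1 eps + 2 * gambar m m1 eps) * (q \<bullet> n)) *\<^sub>R n"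
    unfolding gam_plus_gambar recoil_def ..
  show "vstar m m1 eps (q + w') w' n = recoil n q + w"
    unfolding vstar_def w'_def recoil by (simp add: algebra_simps)
  have "post_velocity (recoil n q + w) (w, n) = recoil n q + w + (2 * gam m m1 eps * (q \<bullet> n)) *\<^sub>R n"
    unfolding post_velocity_def gam_eq by (simp add: normal)
  then show "post_velocity (recoil n q + w) (w, n) = q + w'"
    unfolding w'_def recoil by (simp add: algebra_simps)
qed

lemma nn_integral_recoil:
  assumes "norm n = 1" "f \<in> borel_measurable borel"
  shows "(\<integral>\<^sup>+q. f (recoil n q) \<partial>lborel) = ennreal eps * (\<integral>\<^sup>+q. f q \<partial>lborel)"
proof -
  have "(1 + eps) / eps \<noteq> 1" "1 / \<bar>1 - (1 + eps) / eps\<bar> = eps" using eps_pos by (auto simp: field_simps)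
  then show ?thesis
    using nn_integral_rank_one_update[OF assms(1) _ assms(2), of "(1 + eps) / eps"]
    by (simp add: recoil_def)
qed

lemma nn_integral_collision_change_of_variables:
  fixes f \<phi> :: "vec3 \<Rightarrow> ennreal"
  assumes unit: "norm n = 1"
    and f[measurable]: "f \<in> borel_measurable borel" and \<phi>[measurable]: "\<phi> \<in> borel_measurable borel"
  shows "ennreal (eps powr (-2)) * (\<integral>\<^sup>+v. \<integral>\<^sup>+w. ennreal (\<bar>(v - w) \<bullet> n\<bar> * M (wstar m m1 eps v w n))
             * f (vstar m m1 eps v w n) * \<phi> v \<partial>lborel \<partial>lborel)
       = (\<integral>\<^sup>+v. \<integral>\<^sup>+w. ennreal (\<bar>(v - w) \<bullet> n\<bar> * M w) * f v * \<phi> (post_velocity v (w, n)) \<partial>lborel \<partial>lborel)"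
proof -
  let ?before = "\<lambda>v w. ennreal (\<bar>(v - w) \<bullet> n\<bar> * M (wstar m m1 eps v w n))
      * f (vstar m m1 eps v w n) * \<phi> v"
  let ?after = "\<lambda>v w. ennreal (\<bar>(v - w) \<bullet> n\<bar> * M w) * f v * \<phi> (post_velocity v (w, n))"
  let ?shift = "\<lambda>q. (- (2 * gambar m m1 eps) * (q \<bullet> n)) *\<^sub>R n"
  have [measurable]: "(\<lambda>(v, w). ?before v w) \<in> borel_measurable (borel \<Otimes>\<^sub>M borel)"
    unfolding vstar_def wstar_def by measurable
  have [measurable]: "(\<lambda>(v, w). ?after v w) \<in> borel_measurable (borel \<Otimes>\<^sub>M borel)"
    unfolding post_velocity_def fst_conv snd_conv by measurable
  have pointwise: "?before (q + (w + ?shift q)) (w + ?shift q)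
      = ennreal eps * ?after (recoil n q + w) w" for q w
  proof -
    note collide = collision_in_relative_coordinates(1-3)[OF unit, where q = q and w = w]
    have "ennreal (\<bar>q \<bullet> n\<bar> * M w) = ennreal eps * ennreal (\<bar>recoil n q \<bullet> n\<bar> * M w)"
      using collision_in_relative_coordinates(4)[OF unit, of q] eps_pos
      by (simp add: ennreal_mult[symmetric] Maxw_nonneg mult.assoc)
    then show ?thesis unfolding collide by (simp add: mult.assoc)
  qed
  have "(\<integral>\<^sup>+v. \<integral>\<^sup>+w. ?before v w \<partial>lborel \<partial>lborel)
      = (\<integral>\<^sup>+q. \<integral>\<^sup>+w. ennreal eps * ?after (recoil n q + w) w \<partial>lborel \<partial>lborel)"
    unfolding pointwise[symmetric] by (rule nn_integral_relative_coordinates) measurable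
  also have "\<dots> = (\<integral>\<^sup>+q. ennreal eps * (\<integral>\<^sup>+w. ?after (recoil n q + w) w \<partial>lborel) \<partial>lborel)"
    by (intro nn_integral_cong nn_integral_cmult) measurable
  also have "\<dots> = ennreal eps * (\<integral>\<^sup>+q. \<integral>\<^sup>+w. ?after (recoil n q + w) w \<partial>lborel \<partial>lborel)"
    by (rule nn_integral_cmult) measurable
  also have "(\<integral>\<^sup>+q. \<integral>\<^sup>+w. ?after (recoil n q + w) w \<partial>lborel \<partial>lborel)
      = ennreal eps * (\<integral>\<^sup>+q. \<integral>\<^sup>+w. ?after (q + w) w \<partial>lborel \<partial>lborel)"
    by (rule nn_integral_recoil[OF unit, of "\<lambda>q. \<integral>\<^sup>+w. ?after (q + w) w \<partial>lborel"]) measurable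
  also have "(\<integral>\<^sup>+q. \<integral>\<^sup>+w. ?after (q + w) w \<partial>lborel \<partial>lborel) = (\<integral>\<^sup>+v. \<integral>\<^sup>+w. ?after v w \<partial>lborel \<partial>lborel)"
    using nn_integral_relative_coordinates[of ?after "\<lambda>_. 0"] by simp
  finally have "(\<integral>\<^sup>+v. \<integral>\<^sup>+w. ?before v w \<partial>lborel \<partial>lborel)
      = ennreal eps * (ennreal eps * (\<integral>\<^sup>+v. \<integral>\<^sup>+w. ?after v w \<partial>lborel \<partial>lborel))" .
  moreover have "ennreal (eps powr (-2)) * (ennreal eps * ennreal eps) = 1"
    using eps_pos
    by (simp add: ennreal_mult[symmetric] powr_minus powr_numeral power2_eq_square field_simps)
  ultimately show ?thesis by (simp add: mult.assoc[symmetric])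
qed

lemma K_nn_measurable[measurable (raw)]:
  assumes f: "f \<in> borel_measurable borel" and g: "g \<in> borel_measurable N"
  shows "(\<lambda>x. K_nn f (g x)) \<in> borel_measurable N"
proof -
  have [measurable]: "f \<in> borel_measurable (borel \<Otimes>\<^sub>M borel)" using f by (simp add: borel_prod)
  have "K_nn f \<in> borel_measurable borel" unfolding K_nn_def vstar_def wstar_def by measurable
  with g show ?thesis by (rule measurable_compose)
qed

lemma K_adjoint_measurable[measurable]:
  assumes [measurable]: "\<phi> \<in> borel_measurable borel"
  shows "K_adjoint \<phi> \<in> borel_measurable borel"
  unfolding K_adjoint_def post_velocity_def by measurable

lemma K_nn_duality_velocity:
  fixes f :: "vec3 \<Rightarrow> ennreal"
  assumes f[measurable]: "f \<in> borel_measurable borel" and \<phi>[measurable]: "\<phi> \<in> borel_measurable borel"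
  shows "(\<integral>\<^sup>+v. ennreal (eps powr (-2)) * (\<integral>\<^sup>+p. ennreal (impact v p * M (pre_partner v p))
             * f (pre_velocity v p) * \<phi> v \<partial>\<mu>) \<partial>lborel)
       = (\<integral>\<^sup>+v. f v * K_adjoint \<phi> v \<partial>lborel)"
proof -
  let ?before = "\<lambda>v p. ennreal (impact v p * M (pre_partner v p)) * f (pre_velocity v p) * \<phi> v"
  let ?after = "\<lambda>v p. ennreal (impact v p * M (fst p)) * f v * \<phi> (post_velocity v p)"
  let ?c = "ennreal (eps powr (-2))"
  have [measurable]: "(\<lambda>(v, p). ?before v p) \<in> borel_measurable (borel \<Otimes>\<^sub>M (borel \<Otimes>\<^sub>M borel))"
    unfolding vstar_def wstar_def by measurable
  have [measurable]: "(\<lambda>(v, p). ?after v p) \<in> borel_measurable (borel \<Otimes>\<^sub>M (borel \<Otimes>\<^sub>M borel))"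
    unfolding post_velocity_def by measurable
  have "(\<integral>\<^sup>+v. ?c * (\<integral>\<^sup>+p. ?before v p \<partial>\<mu>) \<partial>lborel) = ?c * (\<integral>\<^sup>+v. \<integral>\<^sup>+p. ?before v p \<partial>\<mu> \<partial>lborel)"
    by (rule nn_integral_cmult) measurable
  also have "\<dots> = ?c * (\<integral>\<^sup>+n. \<integral>\<^sup>+v. \<integral>\<^sup>+w. ?before v (w, n) \<partial>lborel \<partial>lborel \<partial>sphere_meas)"
    by (subst nn_integral_lborel_sphere_swap) measurable
  also have "\<dots> = (\<integral>\<^sup>+n. ?c * (\<integral>\<^sup>+v. \<integral>\<^sup>+w. ?before v (w, n) \<partial>lborel \<partial>lborel) \<partial>sphere_meas)"
    by (rule nn_integral_cmult[symmetric]) measurable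
  also have "\<dots> = (\<integral>\<^sup>+n. \<integral>\<^sup>+v. \<integral>\<^sup>+w. ?after v (w, n) \<partial>lborel \<partial>lborel \<partial>sphere_meas)"
  proof (rule nn_integral_cong_AE)
    show "AE n in sphere_meas. ?c * (\<integral>\<^sup>+v. \<integral>\<^sup>+w. ?before v (w, n) \<partial>lborel \<partial>lborel)
       = (\<integral>\<^sup>+v. \<integral>\<^sup>+w. ?after v (w, n) \<partial>lborel \<partial>lborel)"
      using AE_sphere_meas_norm
      by eventually_elim (use nn_integral_collision_change_of_variables[OF _ f \<phi>] in simp)
  qed
  also have "\<dots> = (\<integral>\<^sup>+v. \<integral>\<^sup>+p. ?after v p \<partial>\<mu> \<partial>lborel)"
    by (rule nn_integral_lborel_sphere_swap[symmetric]) measurable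
  also have "\<dots> = (\<integral>\<^sup>+v. f v * K_adjoint \<phi> v \<partial>lborel)"
    unfolding K_adjoint_def post_velocity_def
    by (intro nn_integral_cong) (simp add: nn_integral_cmult[symmetric] mult_ac)
  finally show ?thesis .
qed

lemma K_nn_duality:
  assumes f[measurable]: "f \<in> borel_measurable borel" and \<phi>[measurable]: "\<phi> \<in> borel_measurable borel"
  shows "(\<integral>\<^sup>+z. K_nn f z * \<phi> (snd z) \<partial>lborel) = (\<integral>\<^sup>+z. f z * K_adjoint \<phi> (snd z) \<partial>lborel)"
proof -
  have velocity: "(\<integral>\<^sup>+v. K_nn f (x, v) * \<phi> v \<partial>lborel) = (\<integral>\<^sup>+v. f (x, v) * K_adjoint \<phi> v \<partial>lborel)" for x
  proof -
    have [measurable]: "f \<in> borel_measurable (borel \<Otimes>\<^sub>M borel)" using f by (simp add: borel_prod)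
    have kernel_measurable: "(\<lambda>p. ennreal (impact v p * M (pre_partner v p)) * f (x, pre_velocity v p))
        \<in> borel_measurable \<mu>" for v
      unfolding vstar_def wstar_def by measurable
    have "(\<integral>\<^sup>+v. K_nn f (x, v) * \<phi> v \<partial>lborel) = (\<integral>\<^sup>+v. ennreal (eps powr (-2)) *
        (\<integral>\<^sup>+p. ennreal (impact v p * M (pre_partner v p)) * f (x, pre_velocity v p) * \<phi> v \<partial>\<mu>) \<partial>lborel)"
      unfolding K_nn_def fst_conv snd_conv mult.assoc[of "ennreal (eps powr (-2))"]
      by (simp only: nn_integral_multc[OF kernel_measurable])
    also have "\<dots> = (\<integral>\<^sup>+v. f (x, v) * K_adjoint \<phi> v \<partial>lborel)"
      by (rule K_nn_duality_velocity) measurable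
    finally show ?thesis .
  qed
  have meas: "(\<lambda>z. K_nn f z * \<phi> (snd z)) \<in> borel_measurable borel"
    "(\<lambda>z. f z * K_adjoint \<phi> (snd z)) \<in> borel_measurable borel"
    by measurable
  show ?thesis
    unfolding nn_integral_lborel_fst_snd(1)[OF meas(1)] nn_integral_lborel_fst_snd(1)[OF meas(2)]
    by (simp add: velocity)
qed

section \<open>Growth of the collision frequency and dissipation of energy\<close>

definition third_moment :: real where
  "third_moment = enn2real (\<integral>\<^sup>+p. ennreal ((1 + norm (fst p)) ^ 3 * M (fst p)) \<partial>\<mu>)"

lemma third_moment_nonneg: "0 \<le> third_moment"
  by (simp add: third_moment_def)

lemma nn_integral_third_moment:
  "(\<integral>\<^sup>+p. ennreal ((1 + norm (fst p)) ^ 3 * M (fst p)) \<partial>\<mu>) = ennreal third_moment"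
proof -
  have sphere: "emeasure sphere_meas UNIV < \<infinity>"
    using sphere_meas.emeasure_finite less_top unfolding infinity_ennreal_def by blast
  have "(\<integral>\<^sup>+p. ennreal ((1 + norm (fst p)) ^ 3 * M (fst p)) \<partial>\<mu>)
     = (\<integral>\<^sup>+w. \<integral>\<^sup>+n. ennreal ((1 + norm w) ^ 3 * M w) \<partial>sphere_meas \<partial>lborel)"
    by (subst sphere_meas.nn_integral_fst[symmetric]) auto
  also have "\<dots> = (\<integral>\<^sup>+w. ennreal ((1 + norm w) ^ 3 * M w) \<partial>lborel) * emeasure sphere_meas UNIV"
    by (simp add: nn_integral_multc)
  also have "\<dots> < \<infinity>"
    using nn_integral_Maxw_moment_finite[OF m1_pos th1_pos] sphere by (auto simp: ennreal_mult_less_top)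
  finally show ?thesis by (simp add: third_moment_def less_top)
qed

lemma impact_le:
  assumes unit: "norm (snd p) = 1"
  shows "impact v p \<le> (1 + norm v) * (1 + norm (fst p)) ^ 3"
proof -
  have "impact v p \<le> norm (v - fst p)" using Cauchy_Schwarz_ineq2[of "v - fst p" "snd p"] unit by simp
  also have "\<dots> \<le> norm v + norm (fst p)" by (rule norm_triangle_ineq4)
  also have "\<dots> \<le> (1 + norm v) * (1 + norm (fst p))" by (simp add: algebra_simps)
  also have "\<dots> \<le> (1 + norm v) * (1 + norm (fst p)) ^ 3"
    by (intro mult_left_mono self_le_power) auto
  finally show ?thesis .
qed

lemma nn_integral_impact_le:
  "(\<integral>\<^sup>+p. ennreal (impact v p * M (fst p)) \<partial>\<mu>) \<le> ennreal ((1 + norm v) * third_moment)"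
proof -
  have "(\<integral>\<^sup>+p. ennreal (impact v p * M (fst p)) \<partial>\<mu>)
     \<le> (\<integral>\<^sup>+p. ennreal (1 + norm v) * ennreal ((1 + norm (fst p)) ^ 3 * M (fst p)) \<partial>\<mu>)"
    using AE_lborel_sphere_norm
  proof (intro nn_integral_mono_AE, eventually_elim)
    case (elim p)
    have "impact v p * M (fst p) \<le> (1 + norm v) * (1 + norm (fst p)) ^ 3 * M (fst p)"
      using impact_le[OF elim(2)] by (rule mult_right_mono) (rule Maxw_nonneg)
    then show ?case
      by (simp add: ennreal_mult[symmetric] Maxw_nonneg mult.assoc ennreal_leI del: ennreal_plus)
  qed
  also have "\<dots> = ennreal ((1 + norm v) * third_moment)"
    by (subst nn_integral_cmult)
      (auto simp: nn_integral_third_moment ennreal_mult third_moment_nonneg simp del: ennreal_plus)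
  finally show ?thesis .
qed

lemma nn_integral_impact: "(\<integral>\<^sup>+p. ennreal (impact v p * M (fst p)) \<partial>\<mu>) = ennreal (\<sigma> v)"
proof -
  have "integrable \<mu> (\<lambda>p. impact v p * M (fst p))"
    using nn_integral_impact_le[of v]
    by (intro integrableI_nonneg)
      (auto simp: Maxw_nonneg less_top[symmetric] top_unique intro: le_less_trans)
  then show ?thesis
    unfolding coll_freq_def by (intro nn_integral_eq_integral) (auto simp: Maxw_nonneg)
qed

lemma \<sigma>_nonneg: "0 \<le> \<sigma> v"
  unfolding coll_freq_def by (intro integral_nonneg_AE) (auto simp: Maxw_nonneg)

lemma \<sigma>_measurable[measurable]: "\<sigma> \<in> borel_measurable borel"
  unfolding coll_freq_def by measurable

lemma K_adjoint_one: "K_adjoint (\<lambda>_. 1) v = ennreal (\<sigma> v)"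
  unfolding K_adjoint_def by (simp add: nn_integral_impact)

definition energy_weight :: "vec3 \<Rightarrow> real" where
  "energy_weight v = 1 + (norm v)\<^sup>2"

lemma energy_weight_ge_1: "1 \<le> energy_weight v"
  by (simp add: energy_weight_def)

lemma energy_weight_nonneg: "0 \<le> energy_weight v"
  by (simp add: energy_weight_def)

lemma energy_weight_measurable[measurable]: "energy_weight \<in> borel_measurable borel"
  unfolding energy_weight_def by measurable

lemma \<sigma>_le_energy_weight: "\<sigma> v \<le> 2 * third_moment * energy_weight v"
proof -
  have "ennreal (\<sigma> v) \<le> ennreal ((1 + norm v) * third_moment)"
    using nn_integral_impact_le[of v] unfolding nn_integral_impact .
  then have "\<sigma> v \<le> (1 + norm v) * third_moment"
    using third_moment_nonneg by (simp add: ennreal_le_iff)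
  also have "1 + norm v \<le> 2 * energy_weight v"
    using zero_le_power2[of "norm v - 1 / 4"]
    unfolding energy_weight_def by (simp add: power2_eq_square algebra_simps)
  then have "(1 + norm v) * third_moment \<le> 2 * energy_weight v * third_moment"
    using third_moment_nonneg by (rule mult_right_mono)
  finally show ?thesis by (simp add: mult_ac)
qed

lemma energy_weight_post_velocity:
  fixes v w n :: vec3
  assumes unit: "norm n = 1"
  defines "a \<equiv> (v - w) \<bullet> n"
  shows "energy_weight (post_velocity v (w, n))
       = energy_weight v - 4 * \<kappa> * ((1 - \<kappa>) * a\<^sup>2 + a * (w \<bullet> n))"
proof -
  have unit_square: "n \<bullet> n = 1" using unit by (simp add: dot_square_norm)
  have normal_component: "v \<bullet> n = a + w \<bullet> n" by (simp add: a_def inner_diff_left)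
  have "(norm (post_velocity v (w, n)))\<^sup>2 = (v - (2 * \<kappa> * a) *\<^sub>R n) \<bullet> (v - (2 * \<kappa> * a) *\<^sub>R n)"
    by (simp add: post_velocity_def a_def power2_norm_eq_inner)
  also have "\<dots> = (norm v)\<^sup>2 - 4 * \<kappa> * a * (v \<bullet> n) + 4 * \<kappa>\<^sup>2 * a\<^sup>2 * (n \<bullet> n)"
    unfolding power2_norm_eq_inner
    by (simp add: inner_diff_left inner_diff_right inner_commute[of n v] power2_eq_square algebra_simps)
  also have "\<dots> = (norm v)\<^sup>2 - 4 * \<kappa> * ((1 - \<kappa>) * a\<^sup>2 + a * (w \<bullet> n))"
    unfolding unit_square normal_component by (simp add: power2_eq_square algebra_simps)
  finally show ?thesis by (simp add: energy_weight_def)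
qed

end

text \<open>The quadratic is nonnegative once \<open>\<bar>a\<bar> > \<bar>b\<bar> / d\<close>.\<close>

lemma abs_mult_neg_quadratic_le:
  fixes a b d :: real
  assumes d: "0 < d"
  shows "\<bar>a\<bar> * - (d * a\<^sup>2 + a * b) \<le> \<bar>b\<bar> ^ 3 / d\<^sup>2"
proof -
  have "- (a * b) \<le> \<bar>a\<bar> * \<bar>b\<bar>" by (metis abs_ge_minus_self abs_mult)
  then have "- (d * a\<^sup>2 + a * b) \<le> \<bar>a\<bar> * (\<bar>b\<bar> - d * \<bar>a\<bar>)"
    by (simp add: power2_eq_square algebra_simps)
  then have factor: "\<bar>a\<bar> * - (d * a\<^sup>2 + a * b) \<le> \<bar>a\<bar> * (\<bar>a\<bar> * (\<bar>b\<bar> - d * \<bar>a\<bar>))"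
    by (rule mult_left_mono) simp
  show ?thesis
  proof (cases "\<bar>a\<bar> \<le> \<bar>b\<bar> / d")
    case True
    have "\<bar>a\<bar> * (\<bar>a\<bar> * (\<bar>b\<bar> - d * \<bar>a\<bar>)) \<le> \<bar>a\<bar> * (\<bar>a\<bar> * \<bar>b\<bar>)"
      using d by (intro mult_left_mono) auto
    also have "\<dots> \<le> (\<bar>b\<bar> / d) * ((\<bar>b\<bar> / d) * \<bar>b\<bar>)"
      using True d by (intro mult_mono) auto
    also have "\<dots> = \<bar>b\<bar> ^ 3 / d\<^sup>2" by (simp add: power2_eq_square power3_eq_cube)
    finally show ?thesis using factor by linarith
  next
    case False
    then have "\<bar>b\<bar> - d * \<bar>a\<bar> \<le> 0" using d by (simp add: field_simps)
    then have "\<bar>a\<bar> * (\<bar>a\<bar> * (\<bar>b\<bar> - d * \<bar>a\<bar>)) \<le> 0" by (intro mult_nonneg_nonpos) auto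
    moreover have "0 \<le> \<bar>b\<bar> ^ 3 / d\<^sup>2" by simp
    ultimately show ?thesis using factor by linarith
  qed
qed

context collision
begin

lemma impact_energy_gain_le:
  assumes unit: "norm (snd p) = 1"
  shows "impact v p * energy_weight (post_velocity v p)
       \<le> impact v p * energy_weight v + 4 * \<kappa> / (1 - \<kappa>)\<^sup>2 * (1 + norm (fst p)) ^ 3"
proof -
  obtain w n where p: "p = (w, n)" by force
  let ?a = "(v - w) \<bullet> n" and ?b = "w \<bullet> n"
  have "\<bar>?a\<bar> * - ((1 - \<kappa>) * ?a\<^sup>2 + ?a * ?b) \<le> \<bar>?b\<bar> ^ 3 / (1 - \<kappa>)\<^sup>2"
    using \<kappa>_bounds by (intro abs_mult_neg_quadratic_le) simp
  also have "\<bar>?b\<bar> ^ 3 \<le> (1 + norm w) ^ 3"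
    using Cauchy_Schwarz_ineq2[of w n] unit p by (intro power_mono) auto
  then have "\<bar>?b\<bar> ^ 3 / (1 - \<kappa>)\<^sup>2 \<le> (1 + norm w) ^ 3 / (1 - \<kappa>)\<^sup>2"
    by (rule divide_right_mono) simp
  finally have "4 * \<kappa> * (\<bar>?a\<bar> * - ((1 - \<kappa>) * ?a\<^sup>2 + ?a * ?b)) \<le> 4 * \<kappa> * ((1 + norm w) ^ 3 / (1 - \<kappa>)\<^sup>2)"
    using \<kappa>_bounds by (intro mult_left_mono) auto
  moreover have "\<bar>?a\<bar> * energy_weight (post_velocity v (w, n))
      = \<bar>?a\<bar> * energy_weight v + 4 * \<kappa> * (\<bar>?a\<bar> * - ((1 - \<kappa>) * ?a\<^sup>2 + ?a * ?b))"
    using unit energy_weight_post_velocity[of n v w]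
    by (simp only: p snd_conv) (simp add: algebra_simps)
  ultimately show ?thesis by (simp add: p)
qed

definition energy_rate :: real where
  "energy_rate = 4 * \<kappa> / (1 - \<kappa>)\<^sup>2 * third_moment"

lemma energy_rate_nonneg: "0 \<le> energy_rate"
  using \<kappa>_bounds third_moment_nonneg by (simp add: energy_rate_def)

lemma K_adjoint_energy_weight_le:
  "K_adjoint (\<lambda>v. ennreal (energy_weight v)) v \<le> ennreal ((\<sigma> v + energy_rate) * energy_weight v)"
proof -
  let ?D = "4 * \<kappa> / (1 - \<kappa>)\<^sup>2"
  have D_nonneg: "0 \<le> ?D" using \<kappa>_bounds by simp
  have "K_adjoint (\<lambda>v. ennreal (energy_weight v)) v
     \<le> (\<integral>\<^sup>+p. ennreal (energy_weight v) * ennreal (impact v p * M (fst p))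
          + ennreal ?D * ennreal ((1 + norm (fst p)) ^ 3 * M (fst p)) \<partial>\<mu>)"
    unfolding K_adjoint_def using AE_lborel_sphere_norm
  proof (intro nn_integral_mono_AE, eventually_elim)
    case (elim p)
    have "impact v p * energy_weight (post_velocity v p) * M (fst p)
        \<le> (impact v p * energy_weight v + ?D * (1 + norm (fst p)) ^ 3) * M (fst p)"
      using impact_energy_gain_le[OF elim(2)] by (rule mult_right_mono) (rule Maxw_nonneg)
    then have "ennreal (impact v p * M (fst p) * energy_weight (post_velocity v p))
        \<le> ennreal (energy_weight v * (impact v p * M (fst p))
            + ?D * ((1 + norm (fst p)) ^ 3 * M (fst p)))"
      by (intro ennreal_leI) (simp add: algebra_simps)
    then show ?case
      using D_nonneg less_imp_le[OF \<kappa>_bounds(1)] energy_weight_nonneg[of v]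
        energy_weight_nonneg[of "post_velocity v p"]
      by (simp add: ennreal_mult[symmetric] ennreal_plus[symmetric] Maxw_nonneg del: ennreal_plus)
  qed
  also have "\<dots> = ennreal (energy_weight v) * ennreal (\<sigma> v) + ennreal ?D * ennreal third_moment"
    by (subst nn_integral_add)
      (auto simp: nn_integral_cmult nn_integral_impact nn_integral_third_moment)
  also have "\<dots> = ennreal (energy_weight v * \<sigma> v + energy_rate)"
    using D_nonneg less_imp_le[OF \<kappa>_bounds(1)] third_moment_nonneg \<sigma>_nonneg[of v]
      energy_weight_nonneg[of v]
    unfolding energy_rate_def
    by (simp add: ennreal_mult[symmetric] ennreal_plus[symmetric] del: ennreal_plus)
  also have "\<dots> \<le> ennreal ((\<sigma> v + energy_rate) * energy_weight v)"
    using mult_left_mono[OF energy_weight_ge_1[of v] energy_rate_nonneg]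
    by (intro ennreal_leI) (simp add: algebra_simps)
  finally show ?thesis .
qed

end

section \<open>The operator \<open>A + K\<close> on representatives\<close>

context collision
begin

abbreviation gain_integrand :: "fn \<Rightarrow> phase \<Rightarrow> vec3 \<times> vec3 \<Rightarrow> real" where
  "gain_integrand f z p \<equiv>
     impact (snd z) p * f (fst z, pre_velocity (snd z) p) * M (pre_partner (snd z) p)"

lemma K_eq: "K f z = eps powr (-2) * (\<integral>p. gain_integrand f z p \<partial>\<mu>)"
  by (simp add: Kop_def Let_def)

lemma gain_integrand_measurable:
  assumes "f \<in> borel_measurable borel"
  shows "gain_integrand f z \<in> borel_measurable \<mu>"
proof -
  have [measurable]: "f \<in> borel_measurable (borel \<Otimes>\<^sub>M borel)" using assms by (simp add: borel_prod)
  show ?thesis unfolding vstar_def wstar_def by measurable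
qed

lemma K_nn_ennreal:
  assumes "\<And>z. 0 \<le> f z"
  shows "K_nn (\<lambda>z. ennreal (f z)) z
      = ennreal (eps powr (-2)) * (\<integral>\<^sup>+p. ennreal (gain_integrand f z p) \<partial>\<mu>)"
  unfolding K_nn_def using assms
  by (intro arg_cong2[where f = "(*)"] refl nn_integral_cong)
    (simp add: ennreal_mult[symmetric] Maxw_nonneg mult_ac)

lemma K_nonneg:
  assumes "\<And>z. 0 \<le> f z"
  shows "0 \<le> K f z"
  unfolding K_eq using assms by (intro mult_nonneg_nonneg integral_nonneg_AE) (auto simp: Maxw_nonneg)

lemma K_eq_K_nn:
  assumes f: "f \<in> borel_measurable borel" and nonneg: "\<And>z. 0 \<le> f z"
  shows "K f z = enn2real (K_nn (\<lambda>z. ennreal (f z)) z)"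
proof -
  have "(\<integral>p. gain_integrand f z p \<partial>\<mu>) = enn2real (\<integral>\<^sup>+p. ennreal (gain_integrand f z p) \<partial>\<mu>)"
    using nonneg gain_integrand_measurable[OF f]
    by (intro integral_eq_nn_integral) (auto simp: Maxw_nonneg)
  then show ?thesis unfolding K_eq K_nn_ennreal[of f, OF nonneg] by (simp add: enn2real_mult)
qed

lemma K_measurable:
  assumes f[measurable]: "f \<in> borel_measurable borel" and nonneg: "\<And>z. 0 \<le> f z"
  shows "K f \<in> borel_measurable borel"
proof -
  have "(\<lambda>z. enn2real (K_nn (\<lambda>z. ennreal (f z)) z)) \<in> borel_measurable borel" by measurable
  then show ?thesis using K_eq_K_nn[OF f nonneg] by (simp cong: measurable_cong)
qed

lemma AE_K_nn_finite:
  assumes f[measurable]: "f \<in> borel_measurable borel" and nonneg: "\<And>z. 0 \<le> f z"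
    and in_L1: "L1 (\<lambda>z. \<sigma> (snd z) * f z)"
  shows "AE z in lborel. K_nn (\<lambda>z. ennreal (f z)) z < \<infinity>"
proof -
  have "(\<integral>\<^sup>+z. K_nn (\<lambda>z. ennreal (f z)) z \<partial>lborel)
      = (\<integral>\<^sup>+z. ennreal (f z) * ennreal (\<sigma> (snd z)) \<partial>lborel)"
    using K_nn_duality[of "\<lambda>z. ennreal (f z)" "\<lambda>_. 1"] by (simp add: K_adjoint_one)
  also have "\<dots> = (\<integral>\<^sup>+z. ennreal (\<sigma> (snd z) * f z) \<partial>lborel)"
    using nonneg \<sigma>_nonneg by (simp add: ennreal_mult mult.commute)
  also have "\<dots> < \<infinity>"
    using in_L1 nonneg \<sigma>_nonneg by (simp add: L1_nonneg_iff)
  finally have "AE z in lborel. K_nn (\<lambda>z. ennreal (f z)) z \<noteq> \<infinity>"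
    by (intro nn_integral_PInf_AE) auto
  then show ?thesis by (simp add: less_top)
qed

lemma AE_gain_integrand_integrable:
  assumes f: "f \<in> borel_measurable borel" and in_L1: "L1 (\<lambda>z. \<sigma> (snd z) * f z)"
  shows "AE z in lborel. integrable \<mu> (gain_integrand f z)"
proof -
  have "L1 (\<lambda>z. \<sigma> (snd z) * \<bar>f z\<bar>)"
    using in_L1 integrable_abs[of lborel "\<lambda>z. \<sigma> (snd z) * f z"] \<sigma>_nonneg by (simp add: L1_def abs_mult)
  then have "AE z in lborel. K_nn (\<lambda>z. ennreal \<bar>f z\<bar>) z < \<infinity>"
    using f by (intro AE_K_nn_finite) auto
  then show ?thesis
  proof eventually_elim
    case (elim z)
    have "ennreal (eps powr (-2)) \<noteq> 0" using eps_pos by simp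
    with elim have "(\<integral>\<^sup>+p. ennreal (gain_integrand (\<lambda>z. \<bar>f z\<bar>) z p) \<partial>\<mu>) < \<infinity>"
      unfolding K_nn_ennreal[of "\<lambda>z. \<bar>f z\<bar>", OF abs_ge_zero] by (auto simp: ennreal_mult_less_top)
    then show ?case
      using gain_integrand_measurable[OF f]
      by (intro integrableI_bounded) (auto simp: abs_mult abs_of_nonneg[OF Maxw_nonneg])
  qed
qed

text \<open>Linearity can fail off a null set: where the gain integrand is not integrable,
  \<^term>\<open>K f z\<close> takes the junk value \<open>0\<close>.\<close>

lemma AE_K_linear:
  assumes "f \<in> borel_measurable borel" "L1 (\<lambda>z. \<sigma> (snd z) * f z)"
    and "f' \<in> borel_measurable borel" "L1 (\<lambda>z. \<sigma> (snd z) * f' z)"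
  shows "AE z in lborel. K (\<lambda>z. f z + c * f' z) z = K f z + c * K f' z"
  using AE_gain_integrand_integrable[OF assms(1,2)] AE_gain_integrand_integrable[OF assms(3,4)]
proof eventually_elim
  case (elim z)
  have "gain_integrand (\<lambda>z. f z + c * f' z) z = (\<lambda>p. gain_integrand f z p + c * gain_integrand f' z p)"
    by (simp add: algebra_simps)
  with elim show ?case unfolding K_eq by (simp add: algebra_simps)
qed

lemma nn_integral_K_duality:
  assumes f[measurable]: "f \<in> borel_measurable borel" and nonneg: "\<And>z. 0 \<le> f z"
    and in_L1: "L1 (\<lambda>z. \<sigma> (snd z) * f z)"
    and g[measurable]: "g \<in> borel_measurable borel" and g_nonneg: "\<And>v. 0 \<le> g v"
  shows "(\<integral>\<^sup>+z. ennreal (g (snd z) * K f z) \<partial>lborel)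
       = (\<integral>\<^sup>+z. ennreal (f z) * K_adjoint (\<lambda>v. ennreal (g v)) (snd z) \<partial>lborel)"
proof -
  have "(\<integral>\<^sup>+z. ennreal (g (snd z) * K f z) \<partial>lborel)
      = (\<integral>\<^sup>+z. K_nn (\<lambda>z. ennreal (f z)) z * ennreal (g (snd z)) \<partial>lborel)"
  proof (rule nn_integral_cong_AE)
    show "AE z in lborel. ennreal (g (snd z) * K f z)
        = K_nn (\<lambda>z. ennreal (f z)) z * ennreal (g (snd z))"
      using AE_K_nn_finite[OF f nonneg in_L1]
    proof eventually_elim
      case (elim z)
      then have "ennreal (K f z) = K_nn (\<lambda>z. ennreal (f z)) z" by (simp add: K_eq_K_nn[OF f nonneg])
      then show ?case using g_nonneg K_nonneg[of f z] nonneg by (simp add: ennreal_mult mult.commute)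
    qed
  qed
  also have "\<dots> = (\<integral>\<^sup>+z. ennreal (f z) * K_adjoint (\<lambda>v. ennreal (g v)) (snd z) \<partial>lborel)"
    by (intro K_nn_duality) auto
  finally show ?thesis .
qed

lemma L1_K:
  assumes f: "f \<in> borel_measurable borel" and nonneg: "\<And>z. 0 \<le> f z"
    and in_L1: "L1 (\<lambda>z. \<sigma> (snd z) * f z)"
  shows "L1 (K f)" and "(\<integral>z. K f z \<partial>lborel) = (\<integral>z. \<sigma> (snd z) * f z \<partial>lborel)"
proof -
  have nn_eq: "(\<integral>\<^sup>+z. ennreal (K f z) \<partial>lborel) = (\<integral>\<^sup>+z. ennreal (\<sigma> (snd z) * f z) \<partial>lborel)"
    using nn_integral_K_duality[OF f nonneg in_L1, of "\<lambda>_. 1"] nonneg \<sigma>_nonneg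
    by (simp add: K_adjoint_one ennreal_mult mult.commute)
  show K: "L1 (K f)"
    using in_L1 K_measurable[OF f nonneg] nn_eq nonneg by (simp add: L1_nonneg_iff K_nonneg \<sigma>_nonneg)
  show "(\<integral>z. K f z \<partial>lborel) = (\<integral>z. \<sigma> (snd z) * f z \<partial>lborel)"
    using nn_eq nonneg L1_measurable[OF K] L1_measurable[OF in_L1]
    by (simp add: integral_eq_nn_integral K_nonneg \<sigma>_nonneg)
qed

lemma Arel_linear:
  assumes "Arel m1 u1 th1 f h" "Arel m1 u1 th1 f' h'"
  shows "Arel m1 u1 th1 (\<lambda>z. f z + c * f' z) (\<lambda>z. h z + c * h' z)"
proof -
  obtain k where k: "L1 h" "T0rel f k" "L1 (\<lambda>z. \<sigma> (snd z) * f z)"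
      "aeq h (\<lambda>z. k z - \<sigma> (snd z) * f z)"
    using assms(1) unfolding Arel_def by blast
  obtain k' where k': "L1 h'" "T0rel f' k'" "L1 (\<lambda>z. \<sigma> (snd z) * f' z)"
      "aeq h' (\<lambda>z. k' z - \<sigma> (snd z) * f' z)"
    using assms(2) unfolding Arel_def by blast
  have "L1 (\<lambda>z. h z + c * h' z)" using k(1) k'(1) by (intro L1_intros)
  moreover have "T0rel (\<lambda>z. f z + c * f' z) (\<lambda>z. k z + c * k' z)"
    using k(2) k'(2) by (rule T0rel_linear)
  moreover have "L1 (\<lambda>z. \<sigma> (snd z) * (f z + c * f' z))"
    using L1_add[OF k(3) L1_scale[OF k'(3), of c]] by (simp add: algebra_simps)
  moreover have "aeq (\<lambda>z. h z + c * h' z) (\<lambda>z. k z + c * k' z - \<sigma> (snd z) * (f z + c * f' z))"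
    using k(4) k'(4) unfolding aeq_def by eventually_elim (simp only:, simp add: algebra_simps)
  ultimately show ?thesis unfolding Arel_def by blast
qed

lemma AKrel_linear:
  assumes AK: "AKrel m m1 eps u1 th1 f g" "AKrel m m1 eps u1 th1 f' g'"
  shows "AKrel m m1 eps u1 th1 (\<lambda>z. f z + c * f' z) (\<lambda>z. g z + c * g' z)"
proof -
  obtain h where h: "L1 g" "Arel m1 u1 th1 f h" "aeq g (\<lambda>z. h z + K f z)"
    using AK(1) unfolding AKrel_def by blast
  obtain h' where h': "L1 g'" "Arel m1 u1 th1 f' h'" "aeq g' (\<lambda>z. h' z + K f' z)"
    using AK(2) unfolding AKrel_def by blast
  have f: "f \<in> borel_measurable borel" "L1 (\<lambda>z. \<sigma> (snd z) * f z)"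
    using h(2) L1_measurable unfolding Arel_def T0rel_def by blast+
  have f': "f' \<in> borel_measurable borel" "L1 (\<lambda>z. \<sigma> (snd z) * f' z)"
    using h'(2) L1_measurable unfolding Arel_def T0rel_def by blast+
  have "L1 (\<lambda>z. g z + c * g' z)" using h(1) h'(1) by (intro L1_intros)
  moreover have "Arel m1 u1 th1 (\<lambda>z. f z + c * f' z) (\<lambda>z. h z + c * h' z)"
    using h(2) h'(2) by (rule Arel_linear)
  moreover have "aeq (\<lambda>z. g z + c * g' z) (\<lambda>z. h z + c * h' z + K (\<lambda>z. f z + c * f' z) z)"
    using h(3) h'(3) AE_K_linear[OF f f', of c] unfolding aeq_def
    by eventually_elim (simp only:, simp add: algebra_simps)
  ultimately show ?thesis unfolding AKrel_def by blast
qed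

definition conservative_AK :: "fn \<Rightarrow> fn \<Rightarrow> bool" where
  "conservative_AK f g \<longleftrightarrow> AKrel m m1 eps u1 th1 f g \<and> (\<integral>z. g z \<partial>lborel) = 0"

lemma conservative_AK_L1: "conservative_AK f g \<Longrightarrow> L1 f \<and> L1 g"
  unfolding conservative_AK_def AKrel_def Arel_def T0rel_def by blast

lemma linear_op_conservative_AK: "linear_op conservative_AK"
  unfolding linear_op_def
proof (intro conjI allI impI)
  fix f g f' g' c assume fg: "conservative_AK f g" "conservative_AK f' g'"
  have "(\<integral>z. g z + c * g' z \<partial>lborel) = 0"
    using fg fg[THEN conservative_AK_L1] by (simp add: conservative_AK_def L1_def)
  then show "conservative_AK (\<lambda>z. f z + c * f' z) (\<lambda>z. g z + c * g' z)"
    using fg AKrel_linear unfolding conservative_AK_def by blast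
qed (auto dest: conservative_AK_L1)

section \<open>The Neumann iteration\<close>

definition lam :: real where "lam = energy_rate + 1"

lemma lam_pos: "0 < lam"
  using energy_rate_nonneg by (simp add: lam_def)

sublocale absorbing_transport "\<lambda>v. lam + \<sigma> v" lam
  by unfold_locales (simp_all add: lam_pos \<sigma>_nonneg)

abbreviation R :: "fn \<Rightarrow> fn" where "R \<equiv> transport_resolvent (\<lambda>v. lam + \<sigma> v)"

lemma L1_R:
  assumes "L1 f"
  shows "L1 (R f)" and "L1 (\<lambda>z. \<sigma> (snd z) * R f z)"
    and "(\<integral>z. \<sigma> (snd z) * R f z \<partial>lborel) = (\<integral>z. f z \<partial>lborel) - lam * (\<integral>z. R f z \<partial>lborel)"
proof -
  show R: "L1 (R f)" using assms integrable_transport_resolvent by (simp add: L1_def)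
  have rate: "L1 (\<lambda>z. (lam + \<sigma> (snd z)) * R f z)"
    "(\<integral>z. (lam + \<sigma> (snd z)) * R f z \<partial>lborel) = (\<integral>z. f z \<partial>lborel)"
    using absorption_transport_resolvent assms by (simp_all add: L1_def)
  show \<sigma>R: "L1 (\<lambda>z. \<sigma> (snd z) * R f z)"
    using L1_diff[OF rate(1) L1_scale[OF R, of lam]] by (simp add: algebra_simps)
  show "(\<integral>z. \<sigma> (snd z) * R f z \<partial>lborel) = (\<integral>z. f z \<partial>lborel) - lam * (\<integral>z. R f z \<partial>lborel)"
    using rate(2) R \<sigma>R by (simp add: L1_def distrib_right)
qed

lemma conservative_AK_R:
  assumes f: "L1 f" and nonneg: "\<And>z. 0 \<le> f z"
  shows "conservative_AK (R f) (\<lambda>z. lam * R f z - f z + K (R f) z)"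
proof -
  note R = L1_R[OF f]
  note R_nonneg = transport_resolvent_nonneg[of f, OF nonneg]
  note KR = L1_K[OF L1_measurable[OF R(1)] R_nonneg R(2)]
  have AR: "L1 (\<lambda>z. lam * R f z - f z)" using R(1) f by (intro L1_intros)
  have "T0rel (R f) (\<lambda>z. (lam + \<sigma> (snd z)) * R f z - f z)"
    using absorbing_transport_axioms f by (rule T0rel_transport_resolvent)
  moreover have "aeq (\<lambda>z. lam * R f z - f z) (\<lambda>z. (lam + \<sigma> (snd z)) * R f z - f z - \<sigma> (snd z) * R f z)"
    by (simp add: aeq_def algebra_simps)
  ultimately have "Arel m1 u1 th1 (R f) (\<lambda>z. lam * R f z - f z)"
    unfolding Arel_def using AR R(2) by blast
  moreover have "L1 (\<lambda>z. lam * R f z - f z + K (R f) z)" using AR KR(1) by (rule L1_add)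
  ultimately have "AKrel m m1 eps u1 th1 (R f) (\<lambda>z. lam * R f z - f z + K (R f) z)"
    unfolding AKrel_def aeq_def by auto
  moreover have "(\<integral>z. lam * R f z - f z + K (R f) z \<partial>lborel) = 0"
    using R f KR by (simp add: L1_def)
  ultimately show ?thesis unfolding conservative_AK_def by blast
qed

definition finite_energy :: "fn \<Rightarrow> bool" where
  "finite_energy f \<longleftrightarrow>
     f \<in> borel_measurable borel \<and> (\<forall>z. 0 \<le> f z) \<and> L1 (\<lambda>z. energy_weight (snd z) * f z)"

definition energy :: "fn \<Rightarrow> real" where
  "energy f = (\<integral>z. energy_weight (snd z) * f z \<partial>lborel)"

lemma energy_nonneg: "finite_energy f \<Longrightarrow> 0 \<le> energy f"
  unfolding energy_def finite_energy_def
  by (intro integral_nonneg_AE AE_I2 mult_nonneg_nonneg energy_weight_nonneg) blast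

lemma finite_energy_L1:
  assumes "finite_energy f"
  shows "L1 f"
proof -
  have f: "f \<in> borel_measurable borel" "\<And>z. 0 \<le> f z"
    and weighted: "integrable lborel (\<lambda>z. energy_weight (snd z) * f z)"
    using assms by (auto simp: finite_energy_def L1_def)
  have "norm (f z) \<le> norm (energy_weight (snd z) * f z)" for z
    using mult_right_mono[OF energy_weight_ge_1[of "snd z"] f(2)[of z]] f(2)[of z]
    by (simp add: energy_weight_nonneg)
  then have "integrable lborel f"
    using f(1) by (intro Bochner_Integration.integrable_bound[OF weighted]) auto
  then show ?thesis by (simp add: L1_def)
qed

text \<open>The energy weight depends on \<open>v\<close> only, so multiplication by it commutes with the resolvent.\<close>

lemma energy_R:
  assumes h: "finite_energy h"
  shows "finite_energy (R h)"
    and "L1 (\<lambda>z. energy_weight (snd z) * (\<sigma> (snd z) * R h z))"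
    and "(\<integral>z. energy_weight (snd z) * (\<sigma> (snd z) * R h z) \<partial>lborel) = energy h - lam * energy (R h)"
proof -
  have nonneg: "\<And>z. 0 \<le> h z" and in_L1: "L1 (\<lambda>z. energy_weight (snd z) * h z)"
    using h by (auto simp: finite_energy_def)
  note weighted = L1_R[OF in_L1, unfolded transport_resolvent_velocity_weight[of _ energy_weight]]
  show "finite_energy (R h)"
    unfolding finite_energy_def
    using weighted(1) L1_measurable[OF L1_R(1)[OF finite_energy_L1[OF h]]]
      transport_resolvent_nonneg[of h, OF nonneg]
    by blast
  show "L1 (\<lambda>z. energy_weight (snd z) * (\<sigma> (snd z) * R h z))"
    "(\<integral>z. energy_weight (snd z) * (\<sigma> (snd z) * R h z) \<partial>lborel) = energy h - lam * energy (R h)"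
    using weighted(2,3) by (simp_all add: mult.left_commute energy_def)
qed

lemma energy_production_R:
  assumes h: "finite_energy h"
  shows "L1 (\<lambda>z. (\<sigma> (snd z) + energy_rate) * energy_weight (snd z) * R h z)"
    and "(\<integral>z. (\<sigma> (snd z) + energy_rate) * energy_weight (snd z) * R h z \<partial>lborel)
        = energy h - energy (R h)"
proof -
  note Rh = energy_R[OF h]
  have weighted: "L1 (\<lambda>z. energy_weight (snd z) * R h z)" using Rh(1) by (simp add: finite_energy_def)
  have expand: "(\<lambda>z. (\<sigma> (snd z) + energy_rate) * energy_weight (snd z) * R h z)
      = (\<lambda>z. energy_weight (snd z) * (\<sigma> (snd z) * R h z) + energy_rate * (energy_weight (snd z) * R h z))"
    by (simp add: algebra_simps)
  show "L1 (\<lambda>z. (\<sigma> (snd z) + energy_rate) * energy_weight (snd z) * R h z)"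
    unfolding expand using Rh(2) weighted by (intro L1_intros)
  have "(\<integral>z. (\<sigma> (snd z) + energy_rate) * energy_weight (snd z) * R h z \<partial>lborel)
      = energy h - lam * energy (R h) + energy_rate * energy (R h)"
    unfolding expand using Rh(2,3) weighted by (simp add: L1_def energy_def)
  also have "\<dots> = energy h - energy (R h)" by (simp add: lam_def algebra_simps)
  finally show "(\<integral>z. (\<sigma> (snd z) + energy_rate) * energy_weight (snd z) * R h z \<partial>lborel)
      = energy h - energy (R h)" .
qed

lemma nn_integral_energy_K_R_le:
  assumes h: "finite_energy h"
  shows "(\<integral>\<^sup>+z. ennreal (energy_weight (snd z) * K (R h) z) \<partial>lborel)
      \<le> ennreal (energy h - energy (R h))"
proof -
  have R: "R h \<in> borel_measurable borel" "\<And>z. 0 \<le> R h z"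
    using energy_R(1)[OF h] by (auto simp: finite_energy_def)
  have "(\<integral>\<^sup>+z. ennreal (energy_weight (snd z) * K (R h) z) \<partial>lborel)
      = (\<integral>\<^sup>+z. ennreal (R h z) * K_adjoint (\<lambda>v. ennreal (energy_weight v)) (snd z) \<partial>lborel)"
    by (rule nn_integral_K_duality[OF R L1_R(2)[OF finite_energy_L1[OF h]]
          energy_weight_measurable energy_weight_nonneg])
  also have "\<dots>
      \<le> (\<integral>\<^sup>+z. ennreal (R h z) * ennreal ((\<sigma> (snd z) + energy_rate) * energy_weight (snd z)) \<partial>lborel)"
    by (intro nn_integral_mono mult_left_mono K_adjoint_energy_weight_le) auto
  also have "\<dots> = (\<integral>\<^sup>+z. ennreal ((\<sigma> (snd z) + energy_rate) * energy_weight (snd z) * R h z) \<partial>lborel)"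
    using R(2) by (simp add: ennreal_mult'[symmetric] mult.commute)
  also have "\<dots> = ennreal (energy h - energy (R h))"
    using energy_production_R[OF h] R(2) \<sigma>_nonneg energy_rate_nonneg energy_weight_nonneg
    by (simp add: nn_integral_eq_integral L1_def)
  finally show ?thesis .
qed

lemma energy_K_R:
  assumes h: "finite_energy h"
  shows "finite_energy (K (R h))" and "energy (K (R h)) + energy (R h) \<le> energy h"
proof -
  have R: "R h \<in> borel_measurable borel" "\<And>z. 0 \<le> R h z"
    using energy_R(1)[OF h] by (auto simp: finite_energy_def)
  have K: "K (R h) \<in> borel_measurable borel" "\<And>z. 0 \<le> K (R h) z"
    using K_measurable[OF R] K_nonneg[of "R h"] R(2) by auto
  note [measurable] = K(1)
  have weighted_nonneg: "0 \<le> energy_weight (snd z) * K (R h) z" for z :: phase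
    using K(2) energy_weight_nonneg by simp
  have "L1 (\<lambda>z. energy_weight (snd z) * K (R h) z)"
    unfolding L1_nonneg_iff[OF weighted_nonneg]
    using nn_integral_energy_K_R_le[OF h] by (auto intro: le_less_trans)
  then show finite: "finite_energy (K (R h))" using K by (simp add: finite_energy_def)
  have "ennreal (energy (K (R h))) \<le> ennreal (energy h - energy (R h))"
    using nn_integral_energy_K_R_le[OF h] finite weighted_nonneg
    by (simp add: energy_def nn_integral_eq_integral finite_energy_def L1_def)
  moreover have "0 \<le> energy h - energy (R h)"
    unfolding energy_production_R(2)[OF h, symmetric]
    using R(2) \<sigma>_nonneg energy_rate_nonneg energy_weight_nonneg by (intro integral_nonneg_AE) simp
  ultimately show "energy (K (R h)) + energy (R h) \<le> energy h" by simp
qed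

lemma l1norm_K_R_le:
  assumes h: "finite_energy h"
  shows "l1norm (K (R h)) \<le> 2 * third_moment * energy (R h)"
proof -
  have R: "R h \<in> borel_measurable borel" "\<And>z. 0 \<le> R h z" "L1 (\<lambda>z. energy_weight (snd z) * R h z)"
    using energy_R(1)[OF h] by (auto simp: finite_energy_def)
  have \<sigma>R: "L1 (\<lambda>z. \<sigma> (snd z) * R h z)" using L1_R(2)[OF finite_energy_L1[OF h]] .
  have "l1norm (K (R h)) = (\<integral>z. \<sigma> (snd z) * R h z \<partial>lborel)"
    using L1_K(2)[OF R(1,2) \<sigma>R] K_nonneg[of "R h"] R(2) by (simp add: l1norm_def)
  also have "\<dots> \<le> (\<integral>z. 2 * third_moment * (energy_weight (snd z) * R h z) \<partial>lborel)"
    using \<sigma>R R(3) mult_right_mono[OF \<sigma>_le_energy_weight R(2)]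
    by (intro integral_mono) (simp_all add: L1_def mult.assoc)
  also have "\<dots> = 2 * third_moment * energy (R h)" by (simp add: energy_def)
  finally show ?thesis .
qed

lemma finite_energy_iterate: "finite_energy h \<Longrightarrow> finite_energy (((\<lambda>h. K (R h)) ^^ n) h)"
  by (induction n) (auto intro: energy_K_R(1))

end

lemma tendsto_0_of_telescoping_bound:
  fixes b w :: "nat \<Rightarrow> real"
  assumes b: "\<And>n. 0 \<le> b n" and w: "\<And>n. 0 \<le> w n" and step: "\<And>n. w (Suc n) + b n \<le> w n"
  shows "b \<longlonglongrightarrow> 0"
proof (rule summable_LIMSEQ_zero, rule summableI_nonneg_bounded[OF b])
  fix n
  have "w n + (\<Sum>k<n. b k) \<le> w 0"
  proof (induction n)
    case (Suc n)
    with step[of n] show ?case by simp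
  qed simp
  with w[of n] show "(\<Sum>k<n. b k) \<le> w 0" by linarith
qed

context collision
begin

lemma iterate_tendsto_0:
  assumes h: "finite_energy h"
  shows "(\<lambda>n. l1norm (((\<lambda>h. K (R h)) ^^ n) h)) \<longlonglongrightarrow> 0"
proof -
  let ?h = "\<lambda>n. ((\<lambda>h. K (R h)) ^^ n) h"
  note fin = finite_energy_iterate[OF h]
  have "(\<lambda>n. energy (R (?h n))) \<longlonglongrightarrow> 0"
  proof (rule tendsto_0_of_telescoping_bound[where w = "\<lambda>n. energy (?h n)"])
    show "energy (?h (Suc n)) + energy (R (?h n)) \<le> energy (?h n)" for n
      using energy_K_R(2)[OF fin] by simp
  qed (use fin energy_R(1) in \<open>auto intro: energy_nonneg\<close>)
  then have "(\<lambda>n. 2 * third_moment * energy (R (?h n))) \<longlonglongrightarrow> 0"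
    by (rule tendsto_mult_right_zero)
  moreover have "l1norm (?h (Suc n)) \<le> 2 * third_moment * energy (R (?h n))" for n
    using l1norm_K_R_le[OF fin] by simp
  ultimately have "(\<lambda>n. l1norm (?h (Suc n))) \<longlonglongrightarrow> 0"
    by (intro l1norm_tendsto_zero_squeeze[where u = "\<lambda>n. 2 * third_moment * energy (R (?h n))"]) auto
  then show ?thesis by (rule LIMSEQ_imp_Suc)
qed

lemma neumann_partial_sum:
  assumes h: "finite_energy h"
  shows "\<exists>f g. conservative_AK f g \<and> (\<forall>z. lam * f z - g z = h z - ((\<lambda>h. K (R h)) ^^ Suc n) h z)"
proof (induction n)
  case 0
  have "conservative_AK (R h) (\<lambda>z. lam * R h z - h z + K (R h) z)"
    using h finite_energy_L1[OF h] by (intro conservative_AK_R) (auto simp: finite_energy_def)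
  then show ?case by (intro exI conjI) auto
next
  case (Suc n)
  let ?h = "((\<lambda>h. K (R h)) ^^ Suc n) h"
  obtain f g where fg: "conservative_AK f g" "\<And>z. lam * f z - g z = h z - ?h z" using Suc by blast
  have fin: "finite_energy ?h" using h by (rule finite_energy_iterate)
  have "conservative_AK (R ?h) (\<lambda>z. lam * R ?h z - ?h z + K (R ?h) z)"
    using fin finite_energy_L1[OF fin] by (intro conservative_AK_R) (auto simp: finite_energy_def)
  then have "conservative_AK (\<lambda>z. f z + 1 * R ?h z) (\<lambda>z. g z + 1 * (lam * R ?h z - ?h z + K (R ?h) z))"
    using fg(1) linear_op_conservative_AK unfolding linear_op_def by blast
  moreover have "lam * (f z + 1 * R ?h z) - (g z + 1 * (lam * R ?h z - ?h z + K (R ?h) z))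
      = h z - ((\<lambda>h. K (R h)) ^^ Suc (Suc n)) h z" for z
    using fg(2)[of z] by (simp add: algebra_simps)
  ultimately show ?case by blast
qed

lemma range_closure_finite_energy:
  assumes h: "finite_energy h"
  shows "range_closure lam conservative_AK h"
  unfolding range_closure_def
proof (intro allI impI)
  fix d :: real assume "0 < d"
  with LIMSEQ_Suc[OF iterate_tendsto_0[OF h]]
  have "\<forall>\<^sub>F n in sequentially. l1norm (((\<lambda>h. K (R h)) ^^ Suc n) h) < d" by (rule order_tendstoD)
  then obtain n where n: "l1norm (((\<lambda>h. K (R h)) ^^ Suc n) h) < d"
    by (auto simp: eventually_sequentially)
  obtain f g where fg: "conservative_AK f g"
    "\<And>z. lam * f z - g z = h z - ((\<lambda>h. K (R h)) ^^ Suc n) h z"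
    using neumann_partial_sum[OF h] by blast
  have "l1norm (\<lambda>z. lam * f z - g z - h z) = l1norm (((\<lambda>h. K (R h)) ^^ Suc n) h)"
    unfolding fg(2) by (simp add: l1norm_def)
  with n have "l1norm (\<lambda>z. lam * f z - g z - h z) < d" by (simp only:)
  with fg(1) show "\<exists>f g. conservative_AK f g \<and> l1norm (\<lambda>z. lam * f z - g z - h z) < d" by blast
qed

lemma finite_energy_bounded_velocity:
  assumes h: "L1 h" and nonneg: "\<And>z. 0 \<le> h z" and supp: "\<And>z. norm (snd z) > r \<Longrightarrow> h z = 0"
  shows "finite_energy h"
proof -
  have weighted_le: "norm (energy_weight (snd z) * h z) \<le> norm ((1 + r\<^sup>2) * h z)" for z
  proof (cases "norm (snd z) \<le> r")
    case True
    then have "energy_weight (snd z) \<le> 1 + r\<^sup>2" by (simp add: energy_weight_def power_mono)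
    then have "energy_weight (snd z) * h z \<le> (1 + r\<^sup>2) * h z" using nonneg by (rule mult_right_mono)
    moreover have "0 \<le> energy_weight (snd z) * h z"
      using energy_weight_nonneg nonneg by (rule mult_nonneg_nonneg)
    ultimately show ?thesis unfolding real_norm_def by linarith
  next
    case False
    then have "h z = 0" by (intro supp) simp
    then show ?thesis by simp
  qed
  note [measurable] = L1_measurable[OF h]
  have "integrable lborel (\<lambda>z. (1 + r\<^sup>2) * h z)" using h by (simp add: L1_def)
  then have "L1 (\<lambda>z. energy_weight (snd z) * h z)"
    unfolding L1_def
    by (rule Bochner_Integration.integrable_bound) (measurable, rule AE_I2, rule weighted_le)
  then show ?thesis using L1_measurable[OF h] nonneg by (simp add: finite_energy_def)
qed

definition velocity_cutoff :: "nat \<Rightarrow> fn \<Rightarrow> fn" where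
  "velocity_cutoff n h z = (if norm (snd z) \<le> real n then h z else 0)"

lemma L1_velocity_cutoff:
  assumes h: "L1 h"
  shows "L1 (velocity_cutoff n h)"
  unfolding L1_def
proof (rule Bochner_Integration.integrable_bound[OF h[unfolded L1_def]])
  note [measurable] = L1_measurable[OF h]
  show "velocity_cutoff n h \<in> borel_measurable lborel" unfolding velocity_cutoff_def by measurable
qed (simp add: velocity_cutoff_def)

lemma velocity_cutoff_tendsto:
  assumes h: "L1 h"
  shows "(\<lambda>n. l1norm (\<lambda>z. velocity_cutoff n h z - h z)) \<longlonglongrightarrow> 0"
proof -
  note [measurable] = L1_measurable[OF h] L1_measurable[OF L1_velocity_cutoff[OF h]]
  have "(\<lambda>n. \<integral>z. \<bar>velocity_cutoff n h z - h z\<bar> \<partial>lborel) \<longlonglongrightarrow> (\<integral>z. 0 \<partial>(lborel :: phase measure))"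
  proof (rule integral_dominated_convergence)
    show "integrable lborel (\<lambda>z. \<bar>h z\<bar>)" using h by (simp add: L1_def)
    show "AE z in lborel. (\<lambda>n. \<bar>velocity_cutoff n h z - h z\<bar>) \<longlonglongrightarrow> 0"
    proof (intro AE_I2)
      fix z :: phase
      obtain N where "norm (snd z) \<le> real N" using real_arch_simple by blast
      then have "\<forall>\<^sub>F n in sequentially. \<bar>velocity_cutoff n h z - h z\<bar> = 0"
        unfolding eventually_sequentially by (intro exI[of _ N]) (auto simp: velocity_cutoff_def)
      then show "(\<lambda>n. \<bar>velocity_cutoff n h z - h z\<bar>) \<longlonglongrightarrow> 0" by (rule tendsto_eventually)
    qed
    show "AE z in lborel. norm \<bar>velocity_cutoff n h z - h z\<bar> \<le> \<bar>h z\<bar>" for n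
      by (intro AE_I2) (simp add: velocity_cutoff_def)
  qed measurable
  then show ?thesis by (simp add: l1norm_def)
qed

lemma dense_range:
  assumes h: "L1 h"
  shows "range_closure lam conservative_AK h"
proof (rule range_closure_closed[OF linear_op_conservative_AK L1_velocity_cutoff[OF h] h _
      velocity_cutoff_tendsto[OF h]])
  fix n
  let ?h = "velocity_cutoff n h"
  let ?pos = "\<lambda>z. max 0 (?h z)" and ?neg = "\<lambda>z. max 0 (- ?h z)"
  have in_L1: "L1 ?pos" "L1 ?neg" using L1_velocity_cutoff[OF h, of n] by (simp_all add: L1_def)
  then have "finite_energy ?pos" "finite_energy ?neg"
    by (intro finite_energy_bounded_velocity[where r = "real n"]; simp add: velocity_cutoff_def)+
  then have "range_closure lam conservative_AK (\<lambda>z. ?pos z - ?neg z)"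
    using in_L1 by (intro range_closure_diff[OF linear_op_conservative_AK] range_closure_finite_energy)
  moreover have "(\<lambda>z. ?pos z - ?neg z) = ?h" by (auto simp: max_def)
  ultimately show "range_closure lam conservative_AK ?h" by simp
qed

end

theorem theorem4p4:
  fixes m m1 eps th1 :: real and u1 :: vec3 and Z :: "real \<Rightarrow> fn \<Rightarrow> fn"
  assumes "m > 0" and "m1 > 0" and "0 < eps" and "eps < 1" and "th1 > 0"
    and Z_sg: "C0_semigroup Z" and Z_pos: "positive_sg Z" and Z_contr: "contraction_sg Z"
    and Z_ext: "extends_op (generator Z) (AKrel m m1 eps u1 th1)"
    and Z_min: "\<And>T. C0_semigroup T \<Longrightarrow> positive_sg T \<Longrightarrow>
                  extends_op (generator T) (AKrel m m1 eps u1 th1) \<Longrightarrow>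
                  \<forall>t\<ge>0. \<forall>f. L1 f \<longrightarrow> (AE z in lborel. 0 \<le> f z) \<longrightarrow>
                     (AE z in lborel. Z t f z \<le> T t f z)"
  shows "(\<forall>f g. generator Z f g \<longleftrightarrow> op_closure (AKrel m m1 eps u1 th1) f g)
       \<and> (\<forall>t\<ge>0. \<forall>f. L1 f \<longrightarrow> (\<integral>z. Z t f z \<partial>lborel) = (\<integral>z. f z \<partial>lborel))"
proof -
  interpret collision m m1 eps th1 u1 by unfold_locales fact+
  interpret contraction_semigroup Z by unfold_locales fact+
  have core: "extends_op (AKrel m m1 eps u1 th1) conservative_AK"
    unfolding extends_op_def conservative_AK_def by blast
  then have ext: "extends_op (generator Z) conservative_AK"
    using Z_ext unfolding extends_op_def by blast
  have null: "(\<integral>z. g z \<partial>lborel) = 0" if "conservative_AK f g" for f g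
    using that unfolding conservative_AK_def by blast
  show ?thesis
  proof (intro conjI allI impI)
    show "generator Z f g \<longleftrightarrow> op_closure (AKrel m m1 eps u1 th1) f g" for f g
      using Z_ext core lam_pos dense_range by (rule generator_eq_op_closure)
    show "(\<integral>z. Z t f z \<partial>lborel) = (\<integral>z. f z \<partial>lborel)" if "0 \<le> t" "L1 f" for t f
      using ext lam_pos dense_range null that by (rule integral_Z_eq)
  qed
qed

end
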